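(* Let $\mathbb T\in\{\mathbb R_+,\mathbb R\}$, let $\mathfrak B$ be a real or complex Banach space, let $1\le p<\infty$, and let $\varphi\in L^p_{loc}(\mathbb T,\mathfrak B)$ be positively Lagrange stable in the shift dynamical system $(L^p_{loc}(\mathbb T,\mathfrak B),\mathbb T,\sigma)$. Assume that: (1) $\varphi$ is $S^p$ remotely almost periodic (respectively, $S^p$ remotely $\tau$-periodic for a given $\tau>0$; or $S^p$ remotely stationary), and its $\omega$-limit set $\omega_\varphi\subset L^p_{loc}(\mathbb T,\mathfrak B)$ is a minimal set of the shift dynamical system $(L^p_{loc}(\mathbb T,\mathfrak B),\mathbb T,\sigma)$; (2) the primitive $F(t):=\int_0^t\varphi(s)\,ds$ ($t\in\mathbb T$) is precompact, i.e. $Q:=\overline{F(\mathbb R_+)}$ is a compact subset of $\mathfrak B$. Then $F\in C(\mathbb T,\mathfrak B)$ is positively remotely almost periodic (respectively, positively remotely $\tau$-periodic; or positively remotely stationary).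
   Context: $|\cdot|$ is the norm of $\mathfrak B$; $\mathbb R_+=[0,\infty)$. $L^p_{loc}(\mathbb T,\mathfrak B)$ is the space of (classes of) strongly measurable functions $f:\mathbb T\to\mathfrak B$ with $\int_{\mathbb T_\ell}|f|^p\,ds<\infty$ for every $\ell>0$ ($\mathbb T_\ell=[-\ell,\ell]$ if $\mathbb T=\mathbb R$, $\mathbb T_\ell=[0,\ell]$ if $\mathbb T=\mathbb R_+$), with the metrizable topology given by the seminorms $\left(\int_{\mathbb T_\ell}|f|^p ds\right)^{1/p}$, $\ell>0$. $C(\mathbb T,\mathfrak B)$ is the space of continuous functions with the compact-open topology. In both spaces the shift dynamical system is $\sigma(h,f)=f^h$, $f^h(t)=f(t+h)$, $h\in\mathbb T$. Positively Lagrange stable: $\{\varphi^h: h\ge 0\}$ is precompact (relatively compact). The $\omega$-limit set $\omega_\varphi$ is the set of all limits $\lim_k\varphi^{t_k}$ with $t_k\to+\infty$. A set $M$ is invariant if $\sigma(t,M)=M$ for all $t\in\mathbb T$; a minimal set is a nonempty closed invariant set having no proper nonempty closed invariant subset. A subset $A\subset\mathbb T$ is relatively dense in $\mathbb T$ if there is $l>0$ with $[a,a+l]\cap A\ne\emptyset$ for all $a\in\mathbb T$. $\varphi\in L^p_{loc}(\mathbb T,\mathfrak B)$ is $S^p$ remotely $\tau$-periodic ($\tau>0$) if $\lim_{t\to+\infty}\int_0^1|\varphi(t+\tau+s)-\varphi(t+s)|^p ds=0$; $S^p$ remotely stationary if it is $S^p$ remotely $\tau$-periodic for every $\tau>0$;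 $S^p$ remotely almost periodic if for every $\varepsilon>0$ there is a relatively dense set $\mathcal P(\varepsilon)\subset\mathbb T$ such that for each $\tau\in\mathcal P(\varepsilon)$ there is $L(\varepsilon,\tau)>0$ with $\int_0^1|\varphi(t+\tau+s)-\varphi(t+s)|^p ds<\varepsilon^p$ for all $t\ge L(\varepsilon,\tau)$. $F\in C(\mathbb T,\mathfrak B)$ is positively remotely $\tau$-periodic if $\lim_{t\to+\infty}|F(t+\tau)-F(t)|=0$; positively remotely stationary if this holds for every $\tau>0$; positively remotely almost periodic if for every $\varepsilon>0$ there is a relatively dense set $\mathcal P(\varepsilon)\subset\mathbb T$ such that for each $\tau\in\mathcal P(\varepsilon)$ there is $L(\varepsilon,\tau)>0$ with $|F(t+\tau)-F(t)|<\varepsilon$ for all $t\ge L(\varepsilon,\tau)$. *)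

theory Defs
  imports "HOL-Analysis.Analysis"
begin

section \<open>Bochner integral in an arbitrary Banach space\<close>

text \<open>
  The Bochner integral of HOL-Analysis is restricted to second countable target spaces.  Since no
  separability is assumed here, we repeat its definition with Borel measurability replaced by strong
  measurability (which is the same in the second countable case, up to null sets).
\<close>

definition strongly_measurable :: "'m measure \<Rightarrow> ('m \<Rightarrow> 'a::real_normed_vector) \<Rightarrow> bool" where
  "strongly_measurable M f \<longleftrightarrow>
     (\<exists>s :: nat \<Rightarrow> 'm \<Rightarrow> 'a. (\<forall>i. simple_function M (s i)) \<and>
        (AE x in M. (\<lambda>i. s i x) \<longlonglongrightarrow> f x))"

definition has_strong_integral :: "'m measure \<Rightarrow> ('m \<Rightarrow> 'a::real_normed_vector) \<Rightarrow> 'a \<Rightarrow> bool" where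
  "has_strong_integral M f x \<longleftrightarrow>
     strongly_measurable M f \<and>
     (\<exists>s :: nat \<Rightarrow> 'm \<Rightarrow> 'a. (\<forall>i. Bochner_Integration.simple_bochner_integrable M (s i)) \<and>
        (\<lambda>i. \<integral>\<^sup>+x. ennreal (norm (f x - s i x)) \<partial>M) \<longlonglongrightarrow> 0 \<and>
        (\<lambda>i. Bochner_Integration.simple_bochner_integral M (s i)) \<longlonglongrightarrow> x)"

definition strong_integral :: "'m measure \<Rightarrow> ('m \<Rightarrow> 'a::real_normed_vector) \<Rightarrow> 'a" where
  "strong_integral M f = (THE x. has_strong_integral M f x)"

definition primitive :: "(real \<Rightarrow> 'a::real_normed_vector) \<Rightarrow> real \<Rightarrow> 'a" where
  "primitive f t =
     (if 0 \<le> t then strong_integral (lebesgue_on {0..t}) f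
      else - strong_integral (lebesgue_on {t..0}) f)"


section \<open>Semigroup and group dynamical systems\<close>

text \<open>
  \<open>X\<close> is the phase space, \<open>T\<close> the set of times (\<open>{0..}\<close> or \<open>UNIV\<close>), and \<open>\<sigma> t x\<close> the state at time
  \<open>t\<close> of the motion starting in \<open>x\<close>.
\<close>

definition pos_Lagrange_stable :: "'x topology \<Rightarrow> (real \<Rightarrow> 'x \<Rightarrow> 'x) \<Rightarrow> 'x \<Rightarrow> bool" where
  "pos_Lagrange_stable X \<sigma> x \<longleftrightarrow> compactin X (X closure_of ((\<lambda>h. \<sigma> h x) ` {0..}))"

definition omega_limit_set ::
    "real set \<Rightarrow> 'x topology \<Rightarrow> (real \<Rightarrow> 'x \<Rightarrow> 'x) \<Rightarrow> 'x \<Rightarrow> 'x set" where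
  "omega_limit_set T X \<sigma> x =
     {y. \<exists>t :: nat \<Rightarrow> real. range t \<subseteq> T \<and> filterlim t at_top sequentially \<and>
           limitin X (\<lambda>k. \<sigma> (t k) x) y sequentially}"

definition invariant_set :: "real set \<Rightarrow> (real \<Rightarrow> 'x \<Rightarrow> 'x) \<Rightarrow> 'x set \<Rightarrow> bool" where
  "invariant_set T \<sigma> M \<longleftrightarrow> (\<forall>t\<in>T. \<sigma> t ` M = M)"

definition minimal_set :: "real set \<Rightarrow> 'x topology \<Rightarrow> (real \<Rightarrow> 'x \<Rightarrow> 'x) \<Rightarrow> 'x set \<Rightarrow> bool" where
  "minimal_set T X \<sigma> M \<longleftrightarrow>
     M \<noteq> {} \<and> closedin X M \<and> invariant_set T \<sigma> M \<and>
     \<not> (\<exists>N. N \<subset> M \<and> N \<noteq> {} \<and> closedin X N \<and> invariant_set T \<sigma> N)"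


section \<open>The shift dynamical system on locally \<open>p\<close>-integrable functions\<close>

text \<open>
  For \<open>T = {0..}\<close> the values of functions at negative arguments are irrelevant: functions are
  identified if they agree almost everywhere on \<open>T\<close>.  The set \<open>T \<inter> {-l..l}\<close> is \<open>{0..l}\<close> for
  \<open>T = {0..}\<close> and \<open>{-l..l}\<close> for \<open>T = UNIV\<close>.
\<close>

definition Lp_loc_fun :: "real \<Rightarrow> real set \<Rightarrow> (real \<Rightarrow> 'a::banach) set" where
  "Lp_loc_fun p T =
     {f. strongly_measurable (lebesgue_on T) f \<and>
         (\<forall>l>0. (\<integral>\<^sup>+s. ennreal (norm (f s) powr p) \<partial>lebesgue_on (T \<inter> {-l..l})) < \<infinity>)}"

definition Lp_class :: "real \<Rightarrow> real set \<Rightarrow> (real \<Rightarrow> 'a::banach) \<Rightarrow> (real \<Rightarrow> 'a) set" where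
  "Lp_class p T f = {g \<in> Lp_loc_fun p T. AE s in lebesgue_on T. g s = f s}"

definition Lp_seminorm :: "real \<Rightarrow> real set \<Rightarrow> real \<Rightarrow> (real \<Rightarrow> 'a::banach) \<Rightarrow> real" where
  "Lp_seminorm p T l f =
     (integral\<^sup>L (lebesgue_on (T \<inter> {-l..l})) (\<lambda>s. norm (f s) powr p)) powr (1 / p)"

text \<open>The points of the space are the classes \<open>Lp_class p T f\<close> with \<open>f \<in> Lp_loc_fun p T\<close>.\<close>

definition Lp_loc :: "real \<Rightarrow> real set \<Rightarrow> (real \<Rightarrow> 'a::banach) set topology" where
  "Lp_loc p T =
     topology_generated_by
       {Lp_class p T ` {g \<in> Lp_loc_fun p T. Lp_seminorm p T l (\<lambda>s. g s - f s) < e} | f l e.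
          f \<in> Lp_loc_fun p T \<and> 0 < l \<and> 0 < e}"

text \<open>
  The shift of a class, written without choosing a representative: for \<open>h \<in> T\<close> and
  \<open>f \<in> Lp_loc_fun p T\<close>, it sends \<open>Lp_class p T f\<close> to \<open>Lp_class p T (\<lambda>t. f (t + h))\<close>.
\<close>

definition Lp_shift ::
    "real \<Rightarrow> real set \<Rightarrow> real \<Rightarrow> (real \<Rightarrow> 'a::banach) set \<Rightarrow> (real \<Rightarrow> 'a) set" where
  "Lp_shift p T h C = (\<Union>f\<in>C. Lp_class p T (\<lambda>t. f (t + h)))"


section \<open>Remote recurrence properties\<close>

definition relatively_dense :: "real set \<Rightarrow> real set \<Rightarrow> bool" where
  "relatively_dense T A \<longleftrightarrow> A \<subseteq> T \<and> (\<exists>l>0. \<forall>a\<in>T. {a..a + l} \<inter> A \<noteq> {})"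

definition Sp_diff :: "real \<Rightarrow> (real \<Rightarrow> 'a::banach) \<Rightarrow> real \<Rightarrow> real \<Rightarrow> real" where
  "Sp_diff p f \<tau> t =
     integral\<^sup>L (lebesgue_on {0..1}) (\<lambda>s. norm (f (t + \<tau> + s) - f (t + s)) powr p)"

definition Sp_remotely_periodic ::
    "real \<Rightarrow> real set \<Rightarrow> real \<Rightarrow> (real \<Rightarrow> 'a::banach) \<Rightarrow> bool" where
  "Sp_remotely_periodic p T \<tau> f \<longleftrightarrow>
     f \<in> Lp_loc_fun p T \<and> 0 < \<tau> \<and> (Sp_diff p f \<tau> \<longlongrightarrow> 0) at_top"

definition Sp_remotely_stationary ::
    "real \<Rightarrow> real set \<Rightarrow> (real \<Rightarrow> 'a::banach) \<Rightarrow> bool" where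
  "Sp_remotely_stationary p T f \<longleftrightarrow> (\<forall>\<tau>>0. Sp_remotely_periodic p T \<tau> f)"

definition Sp_remotely_almost_periodic ::
    "real \<Rightarrow> real set \<Rightarrow> (real \<Rightarrow> 'a::banach) \<Rightarrow> bool" where
  "Sp_remotely_almost_periodic p T f \<longleftrightarrow>
     f \<in> Lp_loc_fun p T \<and>
     (\<forall>\<epsilon>>0. \<exists>P. relatively_dense T P \<and>
        (\<forall>\<tau>\<in>P. \<exists>L>0. \<forall>t\<ge>L. Sp_diff p f \<tau> t < \<epsilon> powr p))"

definition pos_remotely_periodic ::
    "real set \<Rightarrow> real \<Rightarrow> (real \<Rightarrow> 'a::banach) \<Rightarrow> bool" where
  "pos_remotely_periodic T \<tau> F \<longleftrightarrow>
     continuous_on T F \<and> 0 < \<tau> \<and> ((\<lambda>t. norm (F (t + \<tau>) - F t)) \<longlongrightarrow> 0) at_top"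

definition pos_remotely_stationary :: "real set \<Rightarrow> (real \<Rightarrow> 'a::banach) \<Rightarrow> bool" where
  "pos_remotely_stationary T F \<longleftrightarrow> (\<forall>\<tau>>0. pos_remotely_periodic T \<tau> F)"

definition pos_remotely_almost_periodic :: "real set \<Rightarrow> (real \<Rightarrow> 'a::banach) \<Rightarrow> bool" where
  "pos_remotely_almost_periodic T F \<longleftrightarrow>
     continuous_on T F \<and>
     (\<forall>\<epsilon>>0. \<exists>P. relatively_dense T P \<and>
        (\<forall>\<tau>\<in>P. \<exists>L>0. \<forall>t\<ge>L. norm (F (t + \<tau>) - F t) < \<epsilon>))"

end

theory Submission
  imports Defs
begin

text \<open>
  Write \<open>F\<close> for the primitive.  If \<open>\<phi>\<close> is remotely \<open>\<tau>\<close>-periodic, the increment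
  \<open>G t = F (t + \<tau>) - F t\<close> hardly changes along \<open>t, t + \<tau>, t + 2\<tau>, \<dots>\<close>, so \<open>n G t\<close> is close to
  \<open>F (t + n\<tau>) - F t\<close>, which is bounded in \<open>n\<close>; hence \<open>G\<close> tends to \<open>0\<close>.

  In the almost periodic case consider the vectors \<open>c\<close> that are approximated by increments
  \<open>F (t + \<tau>) - F t\<close> with \<open>t\<close> arbitrarily late and \<open>\<tau>\<close> an arbitrarily good remote almost period.
  Minimality of the \<open>\<omega>\<close>-limit set allows one to choose \<open>t\<close> so that the translate of \<open>\<phi>\<close> by \<open>t\<close> is
  close to that by any prescribed late time.  Performing an increment close to \<open>c'\<close> and then one close to
  \<open>c\<close> therefore produces one close to \<open>c + c'\<close>: these vectors form a semigroup, which is bounded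
  because \<open>F\<close> is, and so contains at most \<open>0\<close>.  Compactness of the closure of the range of \<open>F\<close> turns this
  into a uniform estimate.
\<close>

section \<open>Strong measurability and the strong integral\<close>

text \<open>In the periodic case each step of the iteration costs an error of
  \<open>(\<tau> + 1) * \<delta>\<close>, which is harmless because \<tau> is fixed while \<delta>
  tends to 0. In the almost periodic case \<tau> varies with \<delta> and may be arbitrarily large,
  so this product need not be small, and iterating a single \<tau> proves nothing. The choices are
  therefore made in another order: an almost period \<tau> belonging to c comes first, and the
  quality demanded of the almost period \<tau>' belonging to c' is measured against the length of
  \<tau>, so that a shift by \<tau>' hardly disturbs an increment over \<tau>. The late times at
  which \<tau>' produces c' are not under control. A return time bounded in advance, independently
  of \<tau>', allows them to be moved to where \<phi> resembles, on a window of length \<tau>, its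
  behaviour at a time producing c, and the price of the move is fixed before \<tau>' is chosen. All
  these estimates are made with L1 distances on bounded windows; L^p convergence and minimality
  reach them only through \<open>almost_period\<close> and
  \<open>uniformly_recurrent\<close>.\<close>

lemma AE_lebesgue_on_shift:
  fixes h :: real
  assumes "S \<in> sets lebesgue" "S' \<in> sets lebesgue" "\<And>x. x \<in> S' \<Longrightarrow> x + h \<in> S"
    and "AE x in lebesgue_on S. P x"
  shows "AE x in lebesgue_on S'. P (x + h)"
proof -
  have "AE x in lebesgue. x \<in> S \<longrightarrow> P x"
    using assms(1,4) by (simp add: AE_restrict_space_iff)
  then obtain N where N: "negligible N" "{x. \<not> (x \<in> S \<longrightarrow> P x)} \<subseteq> N"
    unfolding eventually_ae_filter_negligible by blast
  have "negligible ((+) (-h) ` N)"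
    using N(1) by (rule negligible_translation)
  moreover have "{x. \<not> (x \<in> S' \<longrightarrow> P (x + h))} \<subseteq> (+) (-h) ` N"
  proof
    fix x assume "x \<in> {x. \<not> (x \<in> S' \<longrightarrow> P (x + h))}"
    then have "x + h \<in> N" using N(2) assms(3) by auto
    then show "x \<in> (+) (-h) ` N" by (intro image_eqI[of _ _ "x + h"]) auto
  qed
  ultimately have "AE x in lebesgue. x \<in> S' \<longrightarrow> P (x + h)"
    unfolding eventually_ae_filter_negligible by blast
  then show ?thesis
    using assms(2) by (simp add: AE_restrict_space_iff)
qed

lemma measurable_lebesgue_on_shift:
  fixes h :: real
  assumes "S \<in> sets lebesgue" "S' \<in> sets lebesgue" "\<And>x. x \<in> S' \<Longrightarrow> x + h \<in> S"
  shows "(\<lambda>x. x + h) \<in> measurable (lebesgue_on S') (lebesgue_on S)"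
proof -
  have *: "(\<lambda>x. x + h) -` A \<in> sets lebesgue" if "A \<in> sets lebesgue" for A
  proof -
    have "(\<lambda>x. x + h) -` A = (+) (-h) ` A"
    proof (intro set_eqI iffI)
      fix x assume "x \<in> (\<lambda>x. x + h) -` A"
      then show "x \<in> (+) (-h) ` A" by (intro image_eqI[of _ _ "x + h"]) auto
    qed auto
    with lebesgue_sets_translation[OF that, of "-h"] show ?thesis by simp
  qed
  show ?thesis
  proof (rule measurableI)
    fix A assume "A \<in> sets (lebesgue_on S)"
    then have A: "A \<in> sets lebesgue" "A \<subseteq> S"
      using assms(1) by (auto simp: sets_restrict_space_iff)
    have "(\<lambda>x. x + h) -` A \<inter> space (lebesgue_on S') = (\<lambda>x. x + h) -` A \<inter> S'"
      by (simp add: space_restrict_space)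
    then show "(\<lambda>x. x + h) -` A \<inter> space (lebesgue_on S') \<in> sets (lebesgue_on S')"
      using *[OF A(1)] assms(2) by (auto simp: sets_restrict_space_iff)
  qed (use assms(3) in \<open>auto simp: space_restrict_space\<close>)
qed

text \<open>Two sets \<open>S\<close> and \<open>S'\<close> are kept apart so that one statement
  covers translations by h and, for h = 0, restriction to a smaller set.\<close>

lemma strongly_measurable_shift:
  fixes h :: real
  assumes "S \<in> sets lebesgue" "S' \<in> sets lebesgue" "\<And>x. x \<in> S' \<Longrightarrow> x + h \<in> S"
    and "strongly_measurable (lebesgue_on S) f"
  shows "strongly_measurable (lebesgue_on S') (\<lambda>x. f (x + h))"
proof -
  obtain s where s: "\<And>i. simple_function (lebesgue_on S) (s i)"
      "AE x in lebesgue_on S. (\<lambda>i. s i x) \<longlonglongrightarrow> f x"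
    using assms(4) unfolding strongly_measurable_def by auto
  have "simple_function (lebesgue_on S') (\<lambda>x. s i (x + h))" for i
    by (rule simple_function_comp[OF measurable_lebesgue_on_shift s(1)]) (use assms in auto)
  moreover have "AE x in lebesgue_on S'. (\<lambda>i. s i (x + h)) \<longlonglongrightarrow> f (x + h)"
    by (rule AE_lebesgue_on_shift[OF assms(1-3) s(2)])
  ultimately show ?thesis
    unfolding strongly_measurable_def by (intro exI[of _ "\<lambda>i x. s i (x + h)"]) auto
qed

lemmas strongly_measurable_subset = strongly_measurable_shift[where h = 0, simplified]

lemma strongly_measurable_diff:
  assumes "strongly_measurable M f" "strongly_measurable M g"
  shows "strongly_measurable M (\<lambda>x. f x - g x)"
proof -
  obtain s t where "\<And>i. simple_function M (s i)" "\<And>i. simple_function M (t i)" and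
    lim: "AE x in M. (\<lambda>i. s i x) \<longlonglongrightarrow> f x" "AE x in M. (\<lambda>i. t i x) \<longlonglongrightarrow> g x"
    using assms unfolding strongly_measurable_def by auto
  then have "\<And>i. simple_function M (\<lambda>x. s i x - t i x)" by auto
  moreover have "AE x in M. (\<lambda>i. s i x - t i x) \<longlonglongrightarrow> f x - g x"
    using lim by eventually_elim (rule tendsto_diff)
  ultimately show ?thesis
    unfolding strongly_measurable_def by (intro exI[of _ "\<lambda>i x. s i x - t i x"]) auto
qed

lemma strongly_measurable_simple:
  "simple_function M s \<Longrightarrow> strongly_measurable M s"
  unfolding strongly_measurable_def by (intro exI[of _ "\<lambda>_. s"] conjI allI always_eventually tendsto_const)

text \<open>Completeness of Lebesgue measure is the reason; extension by 0 outside \<open>S\<close>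
  reduces the claim to the whole line.\<close>

lemma borel_measurable_lebesgue_on_AE:
  fixes f g :: "real \<Rightarrow> real"
  assumes "S \<in> sets lebesgue" "f \<in> borel_measurable (lebesgue_on S)"
    and "AE x in lebesgue_on S. f x = g x"
  shows "g \<in> borel_measurable (lebesgue_on S)"
proof -
  have "(\<lambda>x. if x \<in> S then f x else 0) \<in> borel_measurable lebesgue"
    using assms(1,2) by (simp add: borel_measurable_if)
  moreover have "AE x in lebesgue. (if x \<in> S then f x else 0) = (if x \<in> S then g x else 0)"
    using assms(1,3) by (simp add: AE_restrict_space_iff)
  ultimately have "(\<lambda>x. if x \<in> S then g x else 0) \<in> borel_measurable lebesgue"
    by (rule borel_measurable_AE)
  then show ?thesis
    using assms(1) by (simp add: borel_measurable_if)
qed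

lemma strongly_measurable_norm:
  fixes f :: "real \<Rightarrow> 'a::real_normed_vector"
  assumes "S \<in> sets lebesgue" "strongly_measurable (lebesgue_on S) f"
  shows "(\<lambda>x. norm (f x)) \<in> borel_measurable (lebesgue_on S)"
proof -
  obtain s where s: "\<And>i. simple_function (lebesgue_on S) (s i)"
      "AE x in lebesgue_on S. (\<lambda>i. s i x) \<longlonglongrightarrow> f x"
    using assms(2) unfolding strongly_measurable_def by auto
  have [measurable]: "(\<lambda>x. norm (s i x)) \<in> borel_measurable (lebesgue_on S)" for i
    by (intro borel_measurable_simple_function simple_function_compose1[OF s(1)])
  show ?thesis
  proof (rule borel_measurable_lebesgue_on_AE[OF assms(1)])
    \<comment> \<open>As a total function \<open>lim\<close> is measurable everywhere, including the
      null set on which the simple functions fail to converge.\<close>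
    show "(\<lambda>x. lim (\<lambda>i. norm (s i x))) \<in> borel_measurable (lebesgue_on S)"
      by measurable
    show "AE x in lebesgue_on S. lim (\<lambda>i. norm (s i x)) = norm (f x)"
      using s(2) by eventually_elim (intro limI tendsto_norm)
  qed
qed

section \<open>Gauge integrals, extended nonnegative integrals and the strong integral\<close>

lemma nonneg_measurable_integrable_on:
  fixes f :: "real \<Rightarrow> real"
  assumes "S \<in> sets lebesgue" "f \<in> borel_measurable (lebesgue_on S)" "\<And>x. 0 \<le> f x"
    and "(\<integral>\<^sup>+x. ennreal (f x) \<partial>lebesgue_on S) < \<infinity>"
  shows "f integrable_on S" "(\<integral>\<^sup>+x. ennreal (f x) \<partial>lebesgue_on S) = ennreal (integral S f)"
proof -
  have i: "integrable (lebesgue_on S) f"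
    using assms by (intro integrableI_nonneg) auto
  then show "f integrable_on S"
    using assms(1) by (rule integrable_on_lebesgue_on)
  show "(\<integral>\<^sup>+x. ennreal (f x) \<partial>lebesgue_on S) = ennreal (integral S f)"
    using nn_integral_eq_integral[OF i] assms(3) lebesgue_integral_eq_integral[OF i assms(1)] by simp
qed

text \<open>
  The gauge integral serves as a substitute for the Bochner integral of the library, which requires a
  second countable target.  The hypotheses are inherited by \<open>f\<close> because the error integrals control the
  Riemann sums of \<open>f - s i\<close> in norm.
\<close>

lemma has_integral_L1_limit:
  fixes f :: "real \<Rightarrow> 'a::real_normed_vector"
  assumes s: "\<And>i::nat. (s i has_integral y i) {a..b}"
    and e: "\<And>i. ((\<lambda>x. norm (f x - s i x)) has_integral e i) {a..b}"
    and lim: "e \<longlonglongrightarrow> 0" "y \<longlonglongrightarrow> z"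
  shows "(f has_integral z) {a..b}"
proof -
  have "(f has_integral z) (cbox a b)"
    unfolding has_integral
  proof (intro allI impI)
    fix \<epsilon> :: real assume "\<epsilon> > 0"
    then have pos: "\<epsilon>/4 > 0" by simp
    have "\<forall>\<^sub>F i in sequentially. dist (e i) 0 < \<epsilon>/4 \<and> dist (y i) z < \<epsilon>/4"
      using tendstoD[OF lim(1) pos] tendstoD[OF lim(2) pos] by eventually_elim simp
    then obtain i where i: "\<bar>e i\<bar> < \<epsilon>/4" "norm (y i - z) < \<epsilon>/4"
      by (auto simp: eventually_sequentially dist_norm)
    \<comment> \<open>Error budget: \<open>A\<close> and \<open>B\<close> will be the Riemann sums
      of \<open>f\<close> and \<open>s i\<close>, and \<open>E\<close> that of the norm of their
      difference. \<open>E\<close> is below \<epsilon>/2, and the steps from \<open>B\<close> to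
      \<open>y i\<close> and from \<open>y i\<close> to \<open>z\<close> cost \<epsilon>/4
      each.\<close>
    have aux: "norm (A - z) < \<epsilon>"
      if "norm (A - B) \<le> E" "norm (E - e i) < \<epsilon>/4" "norm (B - y i) < \<epsilon>/4" for A B :: 'a and E :: real
    proof -
      have "norm (A - z) \<le> norm (A - B) + norm (B - y i) + norm (y i - z)"
        by (rule norm_diff_triangle_le[OF norm_diff_triangle_le[OF order_refl order_refl] order_refl])
      also have "\<dots> < E + \<epsilon>/4 + \<epsilon>/4"
        using that i(2) by linarith
      also have "E < \<epsilon>/2"
        using that(2) i(1) by (simp add: abs_if split: if_splits)
      finally show ?thesis by simp
    qed
    obtain \<gamma>1 where \<gamma>1: "gauge \<gamma>1 \<and> (\<forall>D. D tagged_division_of cbox a b \<and> \<gamma>1 fine D \<longrightarrow>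
        norm ((\<Sum>(x,k)\<in>D. measure lborel k *\<^sub>R s i x) - y i) < \<epsilon>/4)"
      using s[of i, folded cbox_interval, unfolded has_integral, rule_format, OF pos] ..
    obtain \<gamma>2 where \<gamma>2: "gauge \<gamma>2 \<and> (\<forall>D. D tagged_division_of cbox a b \<and> \<gamma>2 fine D \<longrightarrow>
        norm ((\<Sum>(x,k)\<in>D. measure lborel k *\<^sub>R norm (f x - s i x)) - e i) < \<epsilon>/4)"
      using e[of i, folded cbox_interval, unfolded has_integral, rule_format, OF pos] ..
    show "\<exists>\<gamma>. gauge \<gamma> \<and> (\<forall>D. D tagged_division_of cbox a b \<and> \<gamma> fine D \<longrightarrow>
        norm ((\<Sum>(x,k)\<in>D. measure lborel k *\<^sub>R f x) - z) < \<epsilon>)"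
    proof (intro exI conjI allI impI)
      show "gauge (\<lambda>x. \<gamma>1 x \<inter> \<gamma>2 x)" by (rule gauge_Int[OF conjunct1[OF \<gamma>1] conjunct1[OF \<gamma>2]])
      fix D assume D: "D tagged_division_of cbox a b \<and> (\<lambda>x. \<gamma>1 x \<inter> \<gamma>2 x) fine D"
      then have fine: "\<gamma>1 fine D" "\<gamma>2 fine D" by (auto simp: fine_Int)
      have 1: "norm ((\<Sum>(x,k)\<in>D. measure lborel k *\<^sub>R s i x) - y i) < \<epsilon>/4"
        by (rule conjunct2[OF \<gamma>1, rule_format, OF conjI[OF conjunct1[OF D] fine(1)]])
      have 2: "norm ((\<Sum>(x,k)\<in>D. measure lborel k *\<^sub>R norm (f x - s i x)) - e i) < \<epsilon>/4"
        by (rule conjunct2[OF \<gamma>2, rule_format, OF conjI[OF conjunct1[OF D] fine(2)]])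
      have "norm ((\<Sum>(x,k)\<in>D. measure lborel k *\<^sub>R f x) - (\<Sum>(x,k)\<in>D. measure lborel k *\<^sub>R s i x))
          = norm (\<Sum>(x,k)\<in>D. measure lborel k *\<^sub>R (f x - s i x))"
        by (simp add: sum_subtractf[symmetric] case_prod_unfold scaleR_diff_right)
      also have "\<dots> \<le> (\<Sum>(x,k)\<in>D. measure lborel k *\<^sub>R norm (f x - s i x))"
        by (rule sum_norm_le) (auto simp: case_prod_unfold)
      finally show "norm ((\<Sum>(x,k)\<in>D. measure lborel k *\<^sub>R f x) - z) < \<epsilon>"
        using 2 1 by (rule aux)
    qed
  qed
  then show ?thesis by simp
qed

text \<open>A simple function is the finite sum of its values times the indicators of its level
  sets, and these indicators are integrable because the interval has finite measure.\<close>

lemma simple_bochner_has_integral: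
  fixes s :: "real \<Rightarrow> 'a::real_normed_vector"
  assumes "Bochner_Integration.simple_bochner_integrable (lebesgue_on {a..b}) s"
  shows "(s has_integral Bochner_Integration.simple_bochner_integral (lebesgue_on {a..b}) s) {a..b}"
proof -
  let ?M = "lebesgue_on {a..b}" and ?R = "s ` {a..b}"
  have sp: "space ?M = {a..b}" by (simp add: space_restrict_space)
  have sf: "simple_function ?M s"
    using assms by (auto elim: simple_bochner_integrable.cases)
  then have fin: "finite ?R" using sp by (auto simp: simple_function_def)
  let ?A = "\<lambda>y. {x\<in>{a..b}. s x = y}"
  have "((\<lambda>x. \<Sum>y\<in>?R. indicator (?A y) x *\<^sub>R y) has_integral (\<Sum>y\<in>?R. measure ?M (?A y) *\<^sub>R y)) {a..b}"
  proof (intro has_integral_sum fin has_integral_scaleR_left)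
    fix y
    have m: "?A y \<in> sets ?M"
      using simple_functionD(2)[OF sf, of "{y}"] sp by (simp add: vimage_def Int_def conj_commute)
    have "emeasure ?M (?A y) \<le> emeasure ?M {a..b}"
      using sp by (intro emeasure_mono) auto
    also have "\<dots> < \<infinity>"
      by (simp add: emeasure_restrict_space emeasure_lborel_Icc_eq)
    finally have "integrable ?M (indicator (?A y) :: real \<Rightarrow> real)"
      using m by (intro integrable_real_indicator)
    from has_integral_integral_lebesgue_on[OF this]
    have "(indicator (?A y) has_integral (measure ?M (?A y \<inter> space ?M))) {a..b}" by simp
    then show "((indicator (?A y) :: real \<Rightarrow> real) has_integral measure ?M (?A y)) {a..b}"
      by (metis (no_types, lifting) Int_absorb2 sp mem_Collect_eq subsetI)
  qed
  moreover have "(\<Sum>y\<in>?R. indicator (?A y) x *\<^sub>R y) = s x" if "x \<in> {a..b}" for x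
  proof -
    have "(\<Sum>y\<in>?R. indicator (?A y) x *\<^sub>R y) = (\<Sum>y\<in>?R. if y = s x then y else 0)"
      using that by (intro sum.cong) (auto simp: indicator_def)
    then show ?thesis using fin that by (simp add: sum.delta)
  qed
  ultimately show ?thesis
    unfolding simple_bochner_integral_def sp by (rule has_integral_eq[rotated]) auto
qed

lemma nonneg_integrable_on_nn_integral:
  fixes f :: "real \<Rightarrow> real"
  assumes "S \<in> sets lebesgue" "f integrable_on S" "\<And>x. 0 \<le> f x"
  shows "(\<integral>\<^sup>+x. ennreal (f x) \<partial>lebesgue_on S) = ennreal (integral S f)"
proof -
  have i: "integrable (lebesgue_on S) f"
    using assms by (intro absolutely_integrable_imp_integrable nonnegative_absolutely_integrable_1) auto
  show ?thesis
    using nn_integral_eq_integral[OF i] assms(3) lebesgue_integral_eq_integral[OF i assms(1)] by simp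
qed

lemma has_strong_integral_imp_has_integral:
  fixes f :: "real \<Rightarrow> 'a::real_normed_vector"
  assumes "has_strong_integral (lebesgue_on {a..b}) f x"
  shows "(f has_integral x) {a..b}"
proof -
  let ?M = "lebesgue_on {a..b}"
  obtain s where f: "strongly_measurable ?M f"
    and s: "\<And>i. Bochner_Integration.simple_bochner_integrable ?M (s i)"
    and lim: "(\<lambda>i. \<integral>\<^sup>+x. ennreal (norm (f x - s i x)) \<partial>?M) \<longlonglongrightarrow> 0"
      "(\<lambda>i. Bochner_Integration.simple_bochner_integral ?M (s i)) \<longlonglongrightarrow> x"
    using assms unfolding has_strong_integral_def by auto
  \<comment> \<open>For small indices the error integrals may be infinite. The sequence is started
    at \<open>N\<close>, from where on they are real numbers \<open>e i\<close>.\<close>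
  obtain N where N: "\<And>i. i \<ge> N \<Longrightarrow> (\<integral>\<^sup>+x. ennreal (norm (f x - s i x)) \<partial>?M) < \<infinity>"
    using order_tendstoD(2)[OF lim(1), of \<infinity>] by (auto simp: eventually_sequentially)
  have m: "(\<lambda>x. norm (f x - s i x)) \<in> borel_measurable ?M" for i
    using s[of i] by (intro strongly_measurable_norm strongly_measurable_diff f strongly_measurable_simple)
      (auto elim: simple_bochner_integrable.cases)
  define e where "e i = integral {a..b} (\<lambda>x. norm (f x - s (i + N) x))" for i
  have i: "(\<lambda>x. norm (f x - s (i + N) x)) integrable_on {a..b}"
    and e: "(\<integral>\<^sup>+x. ennreal (norm (f x - s (i + N) x)) \<partial>?M) = ennreal (e i)" for i
    using nonneg_measurable_integrable_on[OF _ m _ N] unfolding e_def by auto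
  have "(\<lambda>i. ennreal (e i)) \<longlonglongrightarrow> ennreal 0"
    using LIMSEQ_ignore_initial_segment[OF lim(1), of N] unfolding e by simp
  moreover have "0 \<le> e i" for i
    unfolding e_def using i by (intro integral_nonneg) auto
  ultimately have "e \<longlonglongrightarrow> 0"
    by (subst (asm) tendsto_ennreal_iff) auto
  show ?thesis
  proof (rule has_integral_L1_limit)
    show "(s (i + N) has_integral Bochner_Integration.simple_bochner_integral ?M (s (i + N))) {a..b}" for i
      by (rule simple_bochner_has_integral[OF s])
    show "((\<lambda>x. norm (f x - s (i + N) x)) has_integral e i) {a..b}" for i
      unfolding e_def by (rule integrable_integral[OF i])
  qed (use \<open>e \<longlonglongrightarrow> 0\<close> LIMSEQ_ignore_initial_segment[OF lim(2), of N] in auto)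
qed

text \<open>Strong measurability gives only almost everywhere convergence of simple functions.
  Truncation supplies a dominating function, dominated convergence turns this into L1 convergence,
  and the integrals then form a Cauchy sequence in a complete space.\<close>

lemma has_strong_integral_exists:
  fixes f :: "real \<Rightarrow> 'a::banach"
  assumes f: "strongly_measurable (lebesgue_on {a..b}) f"
    and int: "(\<lambda>x. norm (f x)) integrable_on {a..b}"
  shows "\<exists>x. has_strong_integral (lebesgue_on {a..b}) f x"
proof -
  let ?M = "lebesgue_on {a..b}"
  obtain s where s: "\<And>i. simple_function ?M (s i)" "AE x in ?M. (\<lambda>i. s i x) \<longlonglongrightarrow> f x"
    using f unfolding strongly_measurable_def by auto
  \<comment> \<open>Any factor above 1 would do in place of 2: where \<open>f x\<close> is nonzero
    the truncation is eventually inactive, and where \<open>f x\<close> is 0 it forces the value 0.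
    The error is dominated by \<open>3 * norm (f x)\<close>.\<close>
  define s' where "s' i x = (if norm (s i x) \<le> 2 * norm (f x) then s i x else 0)" for i x
  have nf [measurable]: "(\<lambda>x. norm (f x)) \<in> borel_measurable ?M"
    by (rule strongly_measurable_norm[OF _ f]) simp
  have [measurable]: "(\<lambda>x. norm (s i x)) \<in> borel_measurable ?M" for i
    by (intro borel_measurable_simple_function simple_function_compose1[OF s(1)])
  have "{x \<in> space ?M. norm (s i x) \<le> 2 * norm (f x)} \<in> sets ?M" for i
    by measurable
  then have s': "simple_function ?M (s' i)" for i
    unfolding s'_def by (intro simple_function_If s(1) simple_function_const)
  have m: "(\<lambda>x. norm (f x - s' i x)) \<in> borel_measurable ?M" for i
    by (intro strongly_measurable_norm strongly_measurable_diff f strongly_measurable_simple s') simp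
  have bound: "norm (f x - s' i x) \<le> 3 * norm (f x)" for i x
    using norm_triangle_ineq4[of "f x" "s i x"] by (auto simp: s'_def)
  have "(\<lambda>i. \<integral>\<^sup>+x. ennreal (norm (f x - s' i x)) \<partial>?M) \<longlonglongrightarrow> (\<integral>\<^sup>+x. 0 \<partial>?M)"
  proof (rule nn_integral_dominated_convergence[where w = "\<lambda>x. ennreal (3 * norm (f x))"])
    show "(\<integral>\<^sup>+x. ennreal (3 * norm (f x)) \<partial>?M) < \<infinity>"
      using int by (subst nonneg_integrable_on_nn_integral) (auto intro: integrable_on_cmult_left)
    show "AE x in ?M. (\<lambda>i. ennreal (norm (f x - s' i x))) \<longlonglongrightarrow> 0"
      using s(2)
    proof eventually_elim
      case (elim x)
      have "(\<lambda>i. s' i x) \<longlonglongrightarrow> f x"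
      proof (cases "f x = 0")
        case True
        then have "s' i x = 0" for i by (simp add: s'_def)
        then show ?thesis using True by simp
      next
        case False
        then have "\<forall>\<^sub>F i in sequentially. norm (s i x) < 2 * norm (f x)"
          using order_tendstoD(2)[OF tendsto_norm[OF elim], of "2 * norm (f x)"] by simp
        then have "\<forall>\<^sub>F i in sequentially. s i x = s' i x"
          by eventually_elim (simp add: s'_def)
        then show ?thesis using elim by (rule Lim_transform_eventually[rotated])
      qed
      then have "(\<lambda>i. norm (f x - s' i x)) \<longlonglongrightarrow> norm (f x - f x)"
        by (intro tendsto_intros)
      then have "(\<lambda>i. ennreal (norm (f x - s' i x))) \<longlonglongrightarrow> ennreal 0"
        by (intro tendsto_ennrealI) simp
      then show ?case by simp
    qed
  qed (use m bound in \<open>auto intro!: ennreal_leI\<close>)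
  then have lim: "(\<lambda>i. \<integral>\<^sup>+x. ennreal (norm (f x - s' i x)) \<partial>?M) \<longlonglongrightarrow> 0"
    by simp
  have sb: "Bochner_Integration.simple_bochner_integrable ?M (s' i)" for i
  proof (rule simple_bochner_integrable.intros[OF s'])
    have "emeasure ?M {y \<in> space ?M. s' i y \<noteq> 0} \<le> emeasure ?M (space ?M)"
      by (rule emeasure_space)
    also have "\<dots> < \<infinity>"
      by (simp add: space_restrict_space emeasure_restrict_space emeasure_lborel_Icc_eq)
    finally show "emeasure ?M {y \<in> space ?M. s' i y \<noteq> 0} \<noteq> \<infinity>" by simp
  qed
  define I where "I i = Bochner_Integration.simple_bochner_integral ?M (s' i)" for i
  have I: "(s' i has_integral I i) {a..b}" for i
    unfolding I_def by (rule simple_bochner_has_integral[OF sb])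
  define e where "e i = integral {a..b} (\<lambda>x. norm (f x - s' i x))" for i
  have ei: "(\<lambda>x. norm (f x - s' i x)) integrable_on {a..b}" for i
    by (rule measurable_bounded_by_integrable_imp_integrable[OF m integrable_on_cmult_left[OF int, of 3]])
      (use bound in auto)
  have "(\<lambda>i. ennreal (e i)) \<longlonglongrightarrow> ennreal 0"
    using lim nonneg_integrable_on_nn_integral[OF _ ei] by (simp add: e_def)
  moreover have "0 \<le> e i" for i
    unfolding e_def using ei by (intro integral_nonneg) auto
  ultimately have e0: "e \<longlonglongrightarrow> 0"
    by (subst (asm) tendsto_ennreal_iff) auto
  have dI: "norm (I i - I j) \<le> e i + e j" for i j
  proof -
    have h1: "((\<lambda>x. s' i x - s' j x) has_integral I i - I j) {a..b}"
      by (intro has_integral_diff I)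
    have h2: "((\<lambda>x. norm (f x - s' i x) + norm (f x - s' j x)) has_integral e i + e j) {a..b}"
      unfolding e_def by (intro has_integral_add integrable_integral ei)
    have h3: "norm (s' i x - s' j x) \<le> norm (f x - s' i x) + norm (f x - s' j x)" for x
      using norm_triangle_ineq4[of "f x - s' j x" "f x - s' i x"] by (simp add: algebra_simps)
    show ?thesis
      using integral_norm_bound_integral[OF has_integral_integrable[OF h1] has_integral_integrable[OF h2] h3]
      unfolding integral_unique[OF h1] integral_unique[OF h2] .
  qed
  have "Cauchy I"
  proof (rule CauchyI)
    fix \<epsilon> :: real assume "\<epsilon> > 0"
    then obtain N where N: "\<And>n. n \<ge> N \<Longrightarrow> e n < \<epsilon>/2"
      using order_tendstoD(2)[OF e0, of "\<epsilon>/2"] by (auto simp: eventually_sequentially)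
    show "\<exists>M. \<forall>m\<ge>M. \<forall>n\<ge>M. norm (I m - I n) < \<epsilon>"
    proof (intro exI allI impI)
      fix m n assume "N \<le> m" "N \<le> n"
      then show "norm (I m - I n) < \<epsilon>"
        using N[of m] N[of n] dI[of m n] by simp
    qed
  qed
  then obtain x where "I \<longlonglongrightarrow> x"
    using Cauchy_convergent_iff convergent_def by blast
  then show ?thesis
    unfolding has_strong_integral_def using f lim sb by (intro exI[of _ x] exI[of _ s'] conjI allI) (auto simp: I_def[abs_def])
qed

text \<open>The description operator in \<open>strong_integral\<close> picks a well-defined value
  because every candidate is also a gauge integral, and gauge integrals are unique.\<close>

lemma strong_integral_eq_integral:
  fixes f :: "real \<Rightarrow> 'a::banach"
  assumes "strongly_measurable (lebesgue_on {a..b}) f" "(\<lambda>x. norm (f x)) integrable_on {a..b}"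
  shows "f integrable_on {a..b}" "strong_integral (lebesgue_on {a..b}) f = integral {a..b} f"
proof -
  obtain x where x: "has_strong_integral (lebesgue_on {a..b}) f x"
    using has_strong_integral_exists[OF assms] by blast
  then have h: "(f has_integral x) {a..b}"
    by (rule has_strong_integral_imp_has_integral)
  then show "f integrable_on {a..b}" by blast
  have "strong_integral (lebesgue_on {a..b}) f = x"
    unfolding strong_integral_def
    using x h by (intro the_equality) (auto dest!: has_strong_integral_imp_has_integral intro: has_integral_unique)
  then show "strong_integral (lebesgue_on {a..b}) f = integral {a..b} f"
    using h by (simp add: integral_unique)
qed
section \<open>Increments of a primitive\<close>

text \<open>The second assumption is separate because the gauge integral is not absolute:
  integrability of a function does not give integrability of its norm. Only nonnegative times occur,
  which fits both choices of the time set.\<close>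

locale locally_integrable =
  fixes \<phi> :: "real \<Rightarrow> 'a::banach"
  assumes integrable: "0 \<le> a \<Longrightarrow> \<phi> integrable_on {a..b}"
    and integrable_diff:
      "0 \<le> t \<Longrightarrow> 0 \<le> s \<Longrightarrow> (\<lambda>u. norm (\<phi> (t + u) - \<phi> (s + u))) integrable_on {0..K}"
begin

definition F :: "real \<Rightarrow> 'a" where
  "F t = integral {0..t} \<phi>"

text \<open>An L1 distance between translates, since it is the L1 norm that bounds the difference of
  two increments of \<open>F\<close>, and since it is additive in the window
  (\<open>d_add\<close>).\<close>

definition d :: "real \<Rightarrow> real \<Rightarrow> real \<Rightarrow> real" where
  "d K t s = integral {0..K} (\<lambda>u. norm (\<phi> (t + u) - \<phi> (s + u)))"

text \<open>The window has length 1; \<open>d_long\<close> recovers windows of length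
  \<open>K\<close> at the price of a factor \<open>K + 1\<close>.\<close>

definition almost_period :: "real \<Rightarrow> real \<Rightarrow> bool" where
  "almost_period \<delta> \<tau> \<longleftrightarrow> 0 \<le> \<tau> \<and> (\<exists>R\<ge>0. \<forall>t\<ge>R. d 1 (t + \<tau>) t < \<delta>)"

text \<open>The trace that minimality of the \<open>\<omega>\<close>-limit set leaves on the orbit itself.\<close>

definition uniformly_recurrent :: bool where
  "uniformly_recurrent \<longleftrightarrow>
     (\<forall>K \<eta>. 0 \<le> K \<longrightarrow> 0 < \<eta> \<longrightarrow>
        (\<exists>L\<ge>0. \<exists>R\<ge>0. \<forall>t\<ge>R. \<forall>s\<ge>R. \<exists>h. 0 \<le> h \<and> h \<le> L \<and> d K (t + h) s < \<eta>))"

text \<open>The quantifier order matters: a single \<tau> serves every \<open>X\<close>, so t can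
  always be pushed beyond the threshold from which \<tau> acts as an almost period.\<close>

definition asymptotic_increment :: "'a \<Rightarrow> bool" where
  "asymptotic_increment c \<longleftrightarrow>
     (\<forall>\<eta>>0. \<exists>\<tau>. almost_period \<eta> \<tau> \<and> (\<forall>X. \<exists>t\<ge>X. norm (F (t + \<tau>) - F t - c) < \<eta>))"

lemma d_mono: "0 \<le> t \<Longrightarrow> 0 \<le> s \<Longrightarrow> K \<le> L \<Longrightarrow> d K t s \<le> d L t s"
  unfolding d_def by (intro integral_subset_le integrable_diff) auto

lemma d_commute: "d K t s = d K s t"
  by (simp add: d_def norm_minus_commute)

lemma d_triangle:
  assumes "0 \<le> t" "0 \<le> s" "0 \<le> r"
  shows "d K t r \<le> d K t s + d K s r"
proof -
  have "d K t r \<le> integral {0..K} (\<lambda>u. norm (\<phi> (t + u) - \<phi> (s + u)) + norm (\<phi> (s + u) - \<phi> (r + u)))"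
    unfolding d_def using assms
    by (intro integral_le integrable_add integrable_diff norm_diff_triangle_le[OF order_refl order_refl]) auto
  also have "\<dots> = d K t s + d K s r"
    unfolding d_def using assms by (intro integral_add integrable_diff)
  finally show ?thesis .
qed

lemma d_add:
  assumes "0 \<le> t" "0 \<le> s" "0 \<le> K" "0 \<le> L"
  shows "d (K + L) t s = d K t s + d L (t + K) (s + K)"
proof -
  let ?f = "\<lambda>u. norm (\<phi> (t + u) - \<phi> (s + u))"
  have "d (K + L) t s = integral {0..K} ?f + integral {K..K + L} ?f"
    unfolding d_def using assms
    by (intro Henstock_Kurzweil_Integration.integral_combine[symmetric] integrable_diff) auto
  also have "integral {K..K + L} ?f = d L (t + K) (s + K)"
    using integral_shift_real_ivl[of K K "K + L" ?f] by (simp add: d_def add_ac)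
  finally show ?thesis by (simp add: d_def)
qed

lemma F_increment:
  assumes "0 \<le> t" "0 \<le> \<tau>"
  shows "F (t + \<tau>) - F t = integral {0..\<tau>} (\<lambda>u. \<phi> (t + u))"
proof -
  have "F (t + \<tau>) = F t + integral {t..t + \<tau>} \<phi>"
    unfolding F_def using assms
    by (intro Henstock_Kurzweil_Integration.integral_combine[symmetric] integrable) auto
  then show ?thesis
    using integral_shift_real_ivl[of t t "t + \<tau>" \<phi>] by (simp add: add_ac)
qed

lemma F_increment_diff:
  assumes "0 \<le> t" "0 \<le> s" "0 \<le> \<tau>"
  shows "norm ((F (t + \<tau>) - F t) - (F (s + \<tau>) - F s)) \<le> d \<tau> t s"
proof -
  have i: "(\<lambda>u. \<phi> (r + u)) integrable_on {0..\<tau>}" if "0 \<le> r" for r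
    using integrable_shift_real_ivl[OF integrable[OF that, of "r + \<tau>"], of r] by (simp add: add_ac)
  have "(F (t + \<tau>) - F t) - (F (s + \<tau>) - F s) = integral {0..\<tau>} (\<lambda>u. \<phi> (t + u) - \<phi> (s + u))"
    using assms by (simp add: F_increment Henstock_Kurzweil_Integration.integral_diff i)
  then show ?thesis
    unfolding d_def using assms
    by (auto intro!: integral_norm_bound_integral Henstock_Kurzweil_Integration.integrable_diff i integrable_diff)
qed

text \<open>Cutting the window into \<lceil>K\<rceil> unit windows works because each of them starts
  at a time beyond \<open>R\<close>, where the hypothesis applies again.\<close>

lemma d_long:
  assumes "0 \<le> \<tau>" "0 \<le> R" "\<And>t. t \<ge> R \<Longrightarrow> d 1 (t + \<tau>) t < \<delta>" "0 \<le> K" "t \<ge> R"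
  shows "d K (t + \<tau>) t \<le> (K + 1) * \<delta>"
proof -
  have n: "d (real n) (t + \<tau>) t \<le> real n * \<delta>" for n
  proof (induction n)
    case 0
    then show ?case by (simp add: d_def)
  next
    case (Suc n)
    have "d (real n + 1) (t + \<tau>) t = d (real n) (t + \<tau>) t + d 1 (t + \<tau> + real n) (t + real n)"
      using assms by (intro d_add) auto
    also have "\<dots> \<le> real n * \<delta> + \<delta>"
      using Suc assms(3)[of "t + real n"] assms(5) by (simp add: add_ac)
    finally show ?case by (simp add: algebra_simps)
  qed
  have "0 \<le> d 1 (t + \<tau>) t" unfolding d_def using assms by (intro integral_nonneg integrable_diff) auto
  then have \<delta>: "0 \<le> \<delta>" using assms(3)[OF assms(5)] by simp
  define n where "n = nat \<lceil>K\<rceil>"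
  have "K \<le> real n" "real n \<le> K + 1" using assms(4) unfolding n_def by linarith+
  then have "d K (t + \<tau>) t \<le> real n * \<delta>"
    using n[of n] d_mono[of "t + \<tau>" t K "real n"] assms by simp
  also have "\<dots> \<le> (K + 1) * \<delta>"
    using \<open>real n \<le> K + 1\<close> \<delta> by (rule mult_right_mono)
  finally show ?thesis .
qed

lemma F_increment_tendsto_0:
  assumes "0 < \<tau>" "bounded (F ` {0..})" "((\<lambda>t. d 1 (t + \<tau>) t) \<longlongrightarrow> 0) at_top"
  shows "((\<lambda>t. norm (F (t + \<tau>) - F t)) \<longlongrightarrow> 0) at_top"
proof (rule tendstoI)
  fix \<epsilon> :: real assume "\<epsilon> > 0"
  obtain B where "B > 0" and B: "\<And>t. 0 \<le> t \<Longrightarrow> norm (F t) \<le> B"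
    using assms(2) unfolding bounded_pos by auto
  \<comment> \<open>The number of steps makes \<open>2 * B\<close> smaller than
    \<open>n * \<epsilon> / 2\<close>; the later choice of \<delta> makes the drift of
    \<open>G\<close> over all n steps, \<open>n * (\<tau> + 1) * \<delta>\<close>, equal to
    \<epsilon>/2.\<close>
  obtain n :: nat where n: "4 * B / \<epsilon> < real n"
    using reals_Archimedean2 by blast
  have "0 < 4 * B / \<epsilon>" using \<open>B > 0\<close> \<open>\<epsilon> > 0\<close> by simp
  then have "0 < real n" using n by linarith
  define \<delta> where "\<delta> = \<epsilon> / (2 * real n * (\<tau> + 1))"
  have "\<delta> > 0" using \<open>\<epsilon> > 0\<close> \<open>0 < real n\<close> assms(1) by (simp add: \<delta>_def)
  then have "\<forall>\<^sub>F t in at_top. d 1 (t + \<tau>) t < \<delta>"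
    using assms(3) by (rule order_tendstoD(2)[rotated])
  then obtain R0 where R0: "\<And>t. t \<ge> R0 \<Longrightarrow> d 1 (t + \<tau>) t < \<delta>"
    by (auto simp: eventually_at_top_linorder)
  define R where "R = max R0 0"
  define G where "G t = F (t + \<tau>) - F t" for t
  have step: "norm (G (t + \<tau>) - G t) \<le> (\<tau> + 1) * \<delta>" if "t \<ge> R" for t
  proof -
    have "norm (G (t + \<tau>) - G t) \<le> d \<tau> (t + \<tau>) t"
      unfolding G_def using that assms(1) by (intro F_increment_diff) (auto simp: R_def)
    also have "\<dots> \<le> (\<tau> + 1) * \<delta>"
      using that assms(1) R0 by (intro d_long[where R = R]) (auto simp: R_def)
    finally show ?thesis .
  qed
  \<comment> \<open>The drift of \<open>G\<close> after j steps grows linearly in j; it feeds the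
    first estimate, whose error is the sum of these drifts and hence quadratic in j. Both are proved
    in one induction.\<close>
  have many: "norm (F (t + real j * \<tau>) - F t - real j *\<^sub>R G t) \<le> real j * (real j * ((\<tau> + 1) * \<delta>))
       \<and> norm (G (t + real j * \<tau>) - G t) \<le> real j * ((\<tau> + 1) * \<delta>)"
    if "t \<ge> R" for t j
  proof (induction j)
    case 0
    then show ?case by simp
  next
    case (Suc j)
    let ?u = "t + real j * \<tau>" and ?e = "(\<tau> + 1) * \<delta>"
    have e: "0 \<le> ?e" using \<open>\<delta> > 0\<close> assms(1) by simp
    have u: "t + real (Suc j) * \<tau> = ?u + \<tau>" by (simp add: algebra_simps)
    have "norm (G (?u + \<tau>) - G ?u) \<le> ?e"
      using that assms(1) by (intro step) (simp add: add_increasing2)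
    then have 1: "norm (G (?u + \<tau>) - G t) \<le> real (Suc j) * ?e"
      using Suc norm_triangle_ineq[of "G (?u + \<tau>) - G ?u" "G ?u - G t"] by (simp add: algebra_simps)
    have "F (?u + \<tau>) - F t - real (Suc j) *\<^sub>R G t
        = (F ?u - F t - real j *\<^sub>R G t) + (G ?u - G t)"
      by (simp add: G_def algebra_simps)
    also have "norm \<dots> \<le> real j * (real j * ?e) + real j * ?e"
      using Suc by (intro norm_triangle_mono) auto
    also have "\<dots> \<le> real (Suc j) * (real (Suc j) * ?e)"
    proof -
      have "real j * (real j * ?e) + real j * ?e = real j * (real (Suc j) * ?e)"
        by (simp add: algebra_simps)
      also have "\<dots> \<le> real (Suc j) * (real (Suc j) * ?e)"
        using e by (intro mult_right_mono) auto
      finally show ?thesis .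
    qed
    finally show ?case using 1 unfolding u by simp
  qed
  have "norm (G t) < \<epsilon>" if "t \<ge> R" for t
  proof -
    have "norm (real n *\<^sub>R G t) \<le> norm (F (t + real n * \<tau>) - F t - real n *\<^sub>R G t)
        + norm (F (t + real n * \<tau>)) + norm (F t)"
      using norm_triangle_ineq4[of "F (t + real n * \<tau>) - F t" "F (t + real n * \<tau>) - F t - real n *\<^sub>R G t"]
        norm_triangle_ineq4[of "F (t + real n * \<tau>)" "F t"] by simp
    also have "\<dots> \<le> real n * (real n * ((\<tau> + 1) * \<delta>)) + B + B"
      using many[OF that, of n] B[of t] B[of "t + real n * \<tau>"] that assms(1) by (simp add: R_def)
    also have "real n * (real n * ((\<tau> + 1) * \<delta>)) = real n * (\<epsilon> / 2)"
    proof -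
      have "(2 * real n * (\<tau> + 1)) * \<delta> = \<epsilon>"
        using \<open>0 < real n\<close> assms(1) by (simp add: \<delta>_def)
      then have "real n * ((\<tau> + 1) * \<delta>) = \<epsilon> / 2"
        by (simp add: mult.assoc)
      then show ?thesis by simp
    qed
    also have "real n * (\<epsilon> / 2) + B + B < real n * \<epsilon>"
      using n \<open>\<epsilon> > 0\<close> by (simp add: field_simps)
    finally show ?thesis using \<open>0 < real n\<close> by simp
  qed
  then show "\<forall>\<^sub>F t in at_top. dist (norm (F (t + \<tau>) - F t)) 0 < \<epsilon>"
    unfolding eventually_at_top_linorder by (auto simp: G_def)
qed

section \<open>The semigroup of asymptotic increments\<close>

text \<open>Recurrence moves a time t producing c by some h \<le> L to a time resembling s on the
  window of length \<open>K\<close>. Since \<open>L\<close> depends only on \<open>K\<close> and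
  \<eta>, the almost period can be taken so good that this move barely changes its
  increment.\<close>

lemma asymptotic_increment_localized:
  assumes "uniformly_recurrent" "asymptotic_increment c" "0 \<le> K" "0 < \<eta>"
  obtains R where "0 \<le> R" "\<And>s. s \<ge> R \<Longrightarrow> \<exists>\<tau>. almost_period \<eta> \<tau> \<and>
      (\<forall>X. \<exists>t\<ge>X. d K t s < \<eta> \<and> norm (F (t + \<tau>) - F t - c) < \<eta>)"
proof -
  obtain L R where L: "0 \<le> L" "0 \<le> R"
    and rec: "\<And>t s. t \<ge> R \<Longrightarrow> s \<ge> R \<Longrightarrow> \<exists>h. 0 \<le> h \<and> h \<le> L \<and> d K (t + h) s < \<eta>"
    using assms(1)[unfolded uniformly_recurrent_def, rule_format, OF assms(3,4)] by blast
  \<comment> \<open>Of the \<open>L + 2\<close> shares, \<open>L + 1\<close> pay for moving t by h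
    through \<open>d_long\<close> and one for the approximation of c.\<close>
  define \<eta>' where "\<eta>' = \<eta> / (L + 2)"
  have "(L + 2) * \<eta>' = \<eta>" "0 < \<eta>'" using assms(4) L by (auto simp: \<eta>'_def)
  then have \<eta>': "0 < \<eta>'" "\<eta>' + (L + 1) * \<eta>' = \<eta>" by (auto simp: algebra_simps)
  moreover have "0 \<le> (L + 1) * \<eta>'" using \<eta>'(1) L by simp
  ultimately have "\<eta>' \<le> \<eta>" by linarith
  obtain \<tau> where \<tau>: "almost_period \<eta>' \<tau>" and inc: "\<And>X. \<exists>t\<ge>X. norm (F (t + \<tau>) - F t - c) < \<eta>'"
    using assms(2) \<eta>'(1) unfolding asymptotic_increment_def by blast
  obtain R' where "0 \<le> \<tau>" and R': "0 \<le> R'" "\<And>t. t \<ge> R' \<Longrightarrow> d 1 (t + \<tau>) t < \<eta>'"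
    using \<tau> unfolding almost_period_def by auto
  have ap: "almost_period \<eta> \<tau>"
    using \<open>0 \<le> \<tau>\<close> R' \<open>\<eta>' \<le> \<eta>\<close> unfolding almost_period_def by force
  show thesis
  proof (rule that[OF L(2)], rule exI[of _ \<tau>], intro conjI allI ap)
    fix s X assume "s \<ge> R"
    obtain t where t: "t \<ge> max X (max R R')" "norm (F (t + \<tau>) - F t - c) < \<eta>'"
      using inc by blast
    obtain h where h: "0 \<le> h" "h \<le> L" "d K (t + h) s < \<eta>"
      using rec[of t s] t(1) \<open>s \<ge> R\<close> by auto
    \<comment> \<open>The change of the \<tau>-increment under a shift by h equals the difference of
      the two h-increments starting at \<open>t + \<tau>\<close> and t. This exchange puts the
      bounded h, and not \<tau>, in the role of the window length.\<close>
    have "norm ((F (t + \<tau> + h) - F (t + \<tau>)) - (F (t + h) - F t)) \<le> d h (t + \<tau>) t"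
      using t(1) R' h \<open>0 \<le> \<tau>\<close> by (intro F_increment_diff) auto
    also have "\<dots> \<le> d L (t + \<tau>) t"
      using t(1) R' h \<open>0 \<le> \<tau>\<close> by (intro d_mono) auto
    also have "\<dots> \<le> (L + 1) * \<eta>'"
      using t(1) R' L(1) \<open>0 \<le> \<tau>\<close> by (intro d_long) auto
    finally have "norm ((F (t + \<tau> + h) - F (t + \<tau>)) - (F (t + h) - F t)) \<le> (L + 1) * \<eta>'" .
    then have "norm (F (t + h + \<tau>) - F (t + h) - c) < \<eta>"
      using t(2) \<eta>'(2) norm_triangle_ineq[of "F (t + \<tau>) - F t - c" "(F (t + \<tau> + h) - F (t + \<tau>)) - (F (t + h) - F t)"]
      by (simp add: algebra_simps)
    then show "\<exists>t\<ge>X. d K t s < \<eta> \<and> norm (F (t + \<tau>) - F t - c) < \<eta>"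
      using h t(1) by (intro exI[of _ "t + h"]) auto
  qed
qed

text \<open>The increment over \<open>\<tau>' + \<tau>\<close> from t is split at
  \<open>t + \<tau>'\<close>. The first piece is close to c'. The second is close to the
  \<tau>-increment at t because \<tau>' is an almost period, hence close to the one at s because t
  resembles s on a window of length \<tau>, and s was chosen to produce c. This makes four errors of
  at most \<eta>/4.\<close>

lemma asymptotic_increment_add:
  assumes "uniformly_recurrent" "asymptotic_increment c" "asymptotic_increment c'"
  shows "asymptotic_increment (c + c')"
  unfolding asymptotic_increment_def
proof (intro allI impI)
  fix \<eta> :: real assume "0 < \<eta>"
  define \<eta>1 where "\<eta>1 = \<eta> / 4"
  have \<eta>1: "0 < \<eta>1" "4 * \<eta>1 = \<eta>" using \<open>0 < \<eta>\<close> by (auto simp: \<eta>1_def)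
  obtain \<tau> where \<tau>: "almost_period \<eta>1 \<tau>" and inc: "\<And>X. \<exists>t\<ge>X. norm (F (t + \<tau>) - F t - c) < \<eta>1"
    using assms(2) \<eta>1(1) unfolding asymptotic_increment_def by blast
  obtain R where "0 \<le> \<tau>" and R: "0 \<le> R" "\<And>t. t \<ge> R \<Longrightarrow> d 1 (t + \<tau>) t < \<eta>1"
    using \<tau> unfolding almost_period_def by auto
  \<comment> \<open>Fixed only after \<tau>: the almost period \<tau>' must be good enough to
    survive a window of length \<tau>.\<close>
  define \<eta>2 where "\<eta>2 = \<eta>1 / (\<tau> + 1)"
  have \<eta>2: "0 < \<eta>2" "\<eta>2 \<le> \<eta>1" "(\<tau> + 1) * \<eta>2 = \<eta>1"
    using \<eta>1(1) \<open>0 \<le> \<tau>\<close> by (auto simp: \<eta>2_def field_simps)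
  obtain R2 where R2: "0 \<le> R2" "\<And>s. s \<ge> R2 \<Longrightarrow> \<exists>\<tau>'. almost_period \<eta>2 \<tau>' \<and>
      (\<forall>X. \<exists>t\<ge>X. d \<tau> t s < \<eta>2 \<and> norm (F (t + \<tau>') - F t - c') < \<eta>2)"
    using asymptotic_increment_localized[OF assms(1,3) \<open>0 \<le> \<tau>\<close> \<eta>2(1)] by metis
  obtain s where s: "s \<ge> R2" "norm (F (s + \<tau>) - F s - c) < \<eta>1"
    using inc by blast
  obtain \<tau>' where \<tau>': "almost_period \<eta>2 \<tau>'"
    and inc': "\<And>X. \<exists>t\<ge>X. d \<tau> t s < \<eta>2 \<and> norm (F (t + \<tau>') - F t - c') < \<eta>2"
    using R2(2)[OF s(1)] by blast
  obtain R' where "0 \<le> \<tau>'" and R': "0 \<le> R'" "\<And>t. t \<ge> R' \<Longrightarrow> d 1 (t + \<tau>') t < \<eta>2"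
    using \<tau>' unfolding almost_period_def by auto
  show "\<exists>\<sigma>. almost_period \<eta> \<sigma> \<and> (\<forall>X. \<exists>t\<ge>X. norm (F (t + \<sigma>) - F t - (c + c')) < \<eta>)"
  proof (rule exI[of _ "\<tau>' + \<tau>"], intro conjI allI)
    have "d 1 (t + (\<tau>' + \<tau>)) t < \<eta>" if "t \<ge> max R R'" for t
    proof -
      have "d 1 (t + \<tau>' + \<tau>) t \<le> d 1 (t + \<tau>' + \<tau>) (t + \<tau>') + d 1 (t + \<tau>') t"
        using that R \<open>0 \<le> \<tau>\<close> \<open>0 \<le> \<tau>'\<close> by (intro d_triangle) auto
      also have "\<dots> < \<eta>1 + \<eta>2"
        using that \<open>0 \<le> \<tau>'\<close> by (intro add_strict_mono R R') auto
      finally show ?thesis using \<eta>1 \<eta>2 by (simp add: add_ac)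
    qed
    then show "almost_period \<eta> (\<tau>' + \<tau>)"
      unfolding almost_period_def using \<open>0 \<le> \<tau>\<close> \<open>0 \<le> \<tau>'\<close> R(1) by (auto intro!: exI[of _ "max R R'"])
  next
    fix X
    obtain t where t: "t \<ge> max X R'" "d \<tau> t s < \<eta>2" "norm (F (t + \<tau>') - F t - c') < \<eta>2"
      using inc' by blast
    have "norm ((F (t + \<tau>' + \<tau>) - F (t + \<tau>')) - (F (t + \<tau>) - F t)) \<le> d \<tau> (t + \<tau>') t"
      using t(1) R'(1) \<open>0 \<le> \<tau>\<close> \<open>0 \<le> \<tau>'\<close> by (intro F_increment_diff) auto
    also have "\<dots> \<le> (\<tau> + 1) * \<eta>2"
      using t(1) R' \<open>0 \<le> \<tau>\<close> \<open>0 \<le> \<tau>'\<close> by (intro d_long) auto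
    finally have 1: "norm ((F (t + \<tau>' + \<tau>) - F (t + \<tau>')) - (F (t + \<tau>) - F t)) \<le> \<eta>1"
      using \<eta>2(3) by simp
    have "norm ((F (t + \<tau>) - F t) - (F (s + \<tau>) - F s)) \<le> d \<tau> t s"
      using t(1) R'(1) s(1) R2(1) \<open>0 \<le> \<tau>\<close> by (intro F_increment_diff) auto
    then have 2: "norm ((F (t + \<tau>) - F t) - (F (s + \<tau>) - F s)) < \<eta>1"
      using t(2) \<eta>2(2) by linarith
    have "F (t + (\<tau>' + \<tau>)) - F t - (c + c') = ((F (t + \<tau>' + \<tau>) - F (t + \<tau>')) - (F (t + \<tau>) - F t))
        + ((F (t + \<tau>) - F t) - (F (s + \<tau>) - F s)) + (F (s + \<tau>) - F s - c) + (F (t + \<tau>') - F t - c')"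
      by (simp add: algebra_simps)
    also have "norm \<dots> < \<eta>1 + \<eta>1 + \<eta>1 + \<eta>1"
      using 1 2 s(2) t(3) \<eta>2(2) by (intro norm_add_less order_le_less_trans[OF norm_triangle_ineq] add_le_less_mono) auto
    finally show "\<exists>t\<ge>X. norm (F (t + (\<tau>' + \<tau>)) - F t - (c + c')) < \<eta>"
      using t(1) \<eta>1(2) by (intro exI[of _ t]) auto
  qed
qed

lemma asymptotic_increment_eq_0:
  assumes "uniformly_recurrent" "bounded (F ` {0..})" "asymptotic_increment c"
  shows "c = 0"
proof -
  obtain B where B: "\<And>t. 0 \<le> t \<Longrightarrow> norm (F t) \<le> B"
    using assms(2) unfolding bounded_pos by auto
  have bound: "norm a \<le> 2 * B + 1" if a: "asymptotic_increment a" for a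
  proof -
    obtain \<tau> where "almost_period 1 \<tau>" and inc: "\<And>X. \<exists>t\<ge>X. norm (F (t + \<tau>) - F t - a) < 1"
      using a unfolding asymptotic_increment_def by (meson zero_less_one)
    then have "0 \<le> \<tau>" by (simp add: almost_period_def)
    obtain t where "t \<ge> 0" "norm (F (t + \<tau>) - F t - a) < 1" using inc by blast
    then show ?thesis
      using B[of t] B[of "t + \<tau>"] \<open>0 \<le> \<tau>\<close> norm_triangle_ineq4[of "F (t + \<tau>) - F t" "F (t + \<tau>) - F t - a"]
        norm_triangle_ineq4[of "F (t + \<tau>)" "F t"] by simp
  qed
  \<comment> \<open>The multiples start at 1, since additivity alone does not yield that 0 is an
    asymptotic increment.\<close>
  have "asymptotic_increment (real (Suc n) *\<^sub>R c)" for n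
  proof (induction n)
    case 0
    then show ?case using assms(3) by simp
  next
    case (Suc n)
    have "real (Suc (Suc n)) *\<^sub>R c = real (Suc n) *\<^sub>R c + c"
      by (metis of_nat_Suc scaleR_left_distrib scaleR_one add.commute)
    then show ?case using asymptotic_increment_add[OF assms(1) Suc assms(3)] by metis
  qed
  then have n: "real (Suc n) * norm c \<le> 2 * B + 1" for n
    using bound[of "real (Suc n) *\<^sub>R c"] by simp
  show ?thesis
  proof (rule ccontr)
    assume "c \<noteq> 0"
    then obtain n :: nat where "(2 * B + 1) / norm c < real n" using reals_Archimedean2 by blast
    then have "2 * B + 1 < real n * norm c" using \<open>c \<noteq> 0\<close> by (simp add: field_simps)
    also have "\<dots> \<le> real (Suc n) * norm c" by (intro mult_right_mono) auto
    finally show False using n[of n] by simp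
  qed
qed

text \<open>Sequential compactness along times \<open>t k \<ge> k\<close>. The lower bound on the
  norm is a closed condition and survives in the limit, which is what later contradicts c =
  0.\<close>

lemma cluster_value:
  fixes v :: "real \<Rightarrow> 'a"
  assumes "compact D" "\<And>t. 0 \<le> t \<Longrightarrow> v t \<in> D" "\<And>X. \<exists>t\<ge>X. \<epsilon> \<le> norm (v t)"
  obtains c where "c \<in> D" "\<epsilon> \<le> norm c" "\<And>\<eta> X. 0 < \<eta> \<Longrightarrow> \<exists>t\<ge>X. norm (v t - c) < \<eta>"
proof -
  have "\<exists>t. t \<ge> real k \<and> \<epsilon> \<le> norm (v t)" for k :: nat
    using assms(3) by blast
  then obtain t where t: "\<And>k::nat. t k \<ge> real k" "\<And>k. \<epsilon> \<le> norm (v (t k))" by metis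
  have "v (t k) \<in> D" for k using t(1)[of k] by (intro assms(2)) linarith
  then obtain c r where c: "c \<in> D" "strict_mono r" "((\<lambda>k. v (t k)) \<circ> r) \<longlonglongrightarrow> c"
    using assms(1) unfolding compact_def by metis
  have lim: "(\<lambda>k. v (t (r k))) \<longlonglongrightarrow> c" using c(3) by (simp add: o_def)
  show thesis
  proof (rule that[OF c(1)])
    show "\<epsilon> \<le> norm c"
      using tendsto_norm[OF lim] t(2) by (intro tendsto_lowerbound[where F = sequentially]) auto
    fix \<eta> X :: real assume "0 < \<eta>"
    then obtain N where N: "\<And>k. k \<ge> N \<Longrightarrow> norm (v (t (r k)) - c) < \<eta>"
      using LIMSEQ_D[OF lim] by blast
    define k where "k = max N (nat \<lceil>X\<rceil>)"
    have "X \<le> real k" unfolding k_def by linarith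
    also have "\<dots> \<le> real (r k)" using seq_suble[OF c(2)] by simp
    also have "\<dots> \<le> t (r k)" by (rule t)
    finally show "\<exists>t\<ge>X. norm (v t - c) < \<eta>"
      using N[of k] by (auto simp: k_def)
  qed
qed

text \<open>Two successive limits. If every \<delta> = 1/(n+1) admits a bad almost period, its
  increments cluster, as t grows, at some \<open>c n\<close> of norm at least \<epsilon> in the
  compact difference set \<open>D\<close>. A limit of the \<open>c n\<close> along a subsequence is
  then an asymptotic increment of norm at least \<epsilon>, hence nonzero.\<close>

lemma F_increment_small:
  assumes "uniformly_recurrent" "compact (closure (F ` {0..}))" "0 < \<epsilon>"
  obtains \<delta> where "0 < \<delta>"
    "\<And>\<tau>. almost_period \<delta> \<tau> \<Longrightarrow> \<exists>R. \<forall>t\<ge>R. norm (F (t + \<tau>) - F t) < \<epsilon>"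
proof (rule ccontr)
  assume contra: "\<not> thesis"
  define D where "D = {x - y | x y. x \<in> closure (F ` {0..}) \<and> y \<in> closure (F ` {0..})}"
  have "compact D" unfolding D_def by (rule compact_differences[OF assms(2,2)])
  have "\<exists>\<tau> c. almost_period (1 / real (Suc n)) \<tau> \<and> c \<in> D \<and> \<epsilon> \<le> norm c \<and>
      (\<forall>\<eta>>0. \<forall>X. \<exists>t\<ge>X. norm (F (t + \<tau>) - F t - c) < \<eta>)" for n
  proof -
    have "\<exists>\<tau>. almost_period (1 / real (Suc n)) \<tau> \<and> \<not> (\<exists>R. \<forall>t\<ge>R. norm (F (t + \<tau>) - F t) < \<epsilon>)"
    proof (rule ccontr)
      assume "\<nexists>\<tau>. almost_period (1 / real (Suc n)) \<tau> \<and> \<not> (\<exists>R. \<forall>t\<ge>R. norm (F (t + \<tau>) - F t) < \<epsilon>)"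
      then have thesis by (intro that[of "1 / real (Suc n)"]) auto
      with contra show False ..
    qed
    then obtain \<tau> where \<tau>: "almost_period (1 / real (Suc n)) \<tau>"
        "\<And>X. \<exists>t\<ge>X. \<epsilon> \<le> norm (F (t + \<tau>) - F t)"
      by (auto simp: not_less)
    have "F (t + \<tau>) - F t \<in> D" if "0 \<le> t" for t
    proof -
      have "0 \<le> \<tau>" using \<tau>(1) by (simp add: almost_period_def)
      then have "F (t + \<tau>) \<in> closure (F ` {0..})" "F t \<in> closure (F ` {0..})"
        using that by (auto intro!: closure_subset[THEN subsetD])
      then show ?thesis unfolding D_def by blast
    qed
    from cluster_value[OF \<open>compact D\<close> this \<tau>(2)] show ?thesis using \<tau>(1) by metis
  qed
  then obtain \<tau> c where \<tau>: "\<And>n. almost_period (1 / real (Suc n)) (\<tau> n)"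
    and c: "\<And>n. c n \<in> D" "\<And>n. \<epsilon> \<le> norm (c n)"
      "\<And>n \<eta> X. 0 < \<eta> \<Longrightarrow> \<exists>t\<ge>X. norm (F (t + \<tau> n) - F t - c n) < \<eta>"
    by metis
  obtain a r where r: "strict_mono r" and a: "(c \<circ> r) \<longlonglongrightarrow> a"
    using \<open>compact D\<close> c(1) unfolding compact_def by metis
  have "asymptotic_increment a"
    unfolding asymptotic_increment_def
  proof (intro allI impI)
    fix \<eta> :: real assume "0 < \<eta>"
    obtain N where N: "\<And>k. k \<ge> N \<Longrightarrow> norm (c (r k) - a) < \<eta> / 2"
      using LIMSEQ_D[OF a, of "\<eta> / 2"] \<open>0 < \<eta>\<close> by auto
    obtain m :: nat where m: "1 / real (Suc m) < \<eta>"
      using nat_approx_posE[OF \<open>0 < \<eta>\<close>] by metis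
    \<comment> \<open>Large enough for both purposes: \<open>c n\<close> is within \<eta>/2 of
      \<open>a\<close>, and 1/(n+1) is below \<eta>.\<close>
    define n where "n = r (max N m)"
    have "m \<le> n" using seq_suble[OF r, of "max N m"] by (simp add: n_def)
    then have "1 / real (Suc n) \<le> 1 / real (Suc m)" by (simp add: field_simps)
    then have "almost_period \<eta> (\<tau> n)"
      using \<tau>[of n] m unfolding almost_period_def by (meson le_less_trans less_trans less_imp_le)
    moreover have "\<exists>t\<ge>X. norm (F (t + \<tau> n) - F t - a) < \<eta>" for X
    proof -
      obtain t where t: "t \<ge> X" "norm (F (t + \<tau> n) - F t - c n) < \<eta> / 2"
        using c(3)[of "\<eta> / 2" X n] \<open>0 < \<eta>\<close> by auto
      have "norm (c n - a) < \<eta> / 2" unfolding n_def by (rule N) simp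
      then have "norm (F (t + \<tau> n) - F t - a) < \<eta>"
        using t(2) norm_triangle_ineq[of "F (t + \<tau> n) - F t - c n" "c n - a"] by simp
      then show ?thesis using t(1) by blast
    qed
    ultimately show "\<exists>\<tau>. almost_period \<eta> \<tau> \<and> (\<forall>X. \<exists>t\<ge>X. norm (F (t + \<tau>) - F t - a) < \<eta>)"
      by blast
  qed
  moreover have "bounded (F ` {0..})"
    using assms(2) bounded_subset[OF compact_imp_bounded closure_subset] by blast
  ultimately have "a = 0" using asymptotic_increment_eq_0[OF assms(1)] by blast
  moreover have "\<epsilon> \<le> norm a"
    using tendsto_norm[OF a] c(2) by (intro tendsto_lowerbound[where F = sequentially]) auto
  ultimately show False using assms(3) by simp
qed

end
section \<open>Local \<open>L\<^sup>p\<close> distances\<close>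

text \<open>Convexity of the p-th power at a + b, written as the mean of a/(1-\<theta>) and
  b/\<theta> with weights 1-\<theta> and \<theta>. The parameter is kept free because the
  coefficient of \<open>a powr p\<close> tends to 1 as \<theta> tends to 0.\<close>

lemma powr_add_le:
  fixes a b p \<theta> :: real
  assumes "1 \<le> p" "0 \<le> a" "0 \<le> b" "0 < \<theta>" "\<theta> < 1"
  shows "(a + b) powr p \<le> (1 - \<theta>) powr (1 - p) * a powr p + \<theta> powr (1 - p) * b powr p"
proof -
  have ge1: "1 \<le> x powr (1 - p)" if "0 < x" "x < 1" for x :: real
    using powr_mono'[of "1 - p" 0 x] that assms(1) by simp
  consider "a = 0" | "b = 0" | "0 < a" "0 < b" using assms by linarith
  then show ?thesis
  proof cases
    case 1
    then show ?thesis using ge1[of \<theta>] assms mult_right_mono[of 1 "\<theta> powr (1 - p)" "b powr p"] by simp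
  next
    case 2
    then show ?thesis using ge1[of "1 - \<theta>"] assms mult_right_mono[of 1 "(1 - \<theta>) powr (1 - p)" "a powr p"] by simp
  next
    case 3
    have "((1 - \<theta>) *\<^sub>R (a / (1 - \<theta>)) + \<theta> *\<^sub>R (b / \<theta>)) powr p
        \<le> (1 - \<theta>) * (a / (1 - \<theta>)) powr p + \<theta> * (b / \<theta>) powr p"
      using assms 3 by (intro convex_onD[OF powr_convex]) auto
    moreover have "(1 - \<theta>) *\<^sub>R (a / (1 - \<theta>)) + \<theta> *\<^sub>R (b / \<theta>) = a + b"
      using assms by simp
    moreover have "c * (x / c) powr p = c powr (1 - p) * x powr p" if "0 < c" "0 < x" for c x :: real
      using that by (simp add: powr_divide powr_diff)
    ultimately show ?thesis using assms 3 by simp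
  qed
qed

text \<open>Either x \<le> \<eta>, or x/\<eta> exceeds 1 and x can only grow when multiplied by its
  power p-1. Integrated, this takes the place of Hoelder's inequality.\<close>

lemma le_add_powr:
  fixes x \<eta> p :: real
  assumes "1 \<le> p" "0 < \<eta>" "0 \<le> x"
  shows "x \<le> \<eta> + \<eta> powr (1 - p) * x powr p"
proof (cases "x \<le> \<eta>")
  case False
  then have "1 \<le> (x / \<eta>) powr (p - 1)"
    using assms by (intro ge_one_powr_ge_zero) auto
  then have "x * 1 \<le> x * (x / \<eta>) powr (p - 1)"
    using assms by (intro mult_left_mono) auto
  also have "\<dots> = \<eta> powr (1 - p) * x powr p"
    using assms False by (simp add: powr_divide powr_diff field_simps)
  finally show ?thesis using assms by simp
qed (simp add: add_increasing2)

text \<open>The p-th power of the L^p distance over \<open>S\<close>, kept without the root; the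
  price is the weighted triangle inequality \<open>rho_triangle\<close>.\<close>

definition rho :: "real \<Rightarrow> real set \<Rightarrow> (real \<Rightarrow> 'a::banach) \<Rightarrow> (real \<Rightarrow> 'a) \<Rightarrow> real" where
  "rho p S f g = integral S (\<lambda>x. norm (f x - g x) powr p)"

lemma rho_commute: "rho p S f g = rho p S g f"
  by (simp add: rho_def norm_minus_commute)

lemma rho_shift: "rho p {a..b} (\<lambda>x. f (x + h)) (\<lambda>x. g (x + h)) = rho p {a + h..b + h} f g"
  using integral_shift_real_ivl[of "a + h" h "b + h" "\<lambda>x. norm (f x - g x) powr p"]
  by (simp add: rho_def)

locale Lp_space =
  fixes T :: "real set" and p :: real
  assumes T: "T = {0..} \<or> T = UNIV" and p: "1 \<le> p"
begin

lemma T_lebesgue [simp]: "T \<in> sets lebesgue"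
  using T by auto

lemma T_add: "x \<in> T \<Longrightarrow> h \<in> T \<Longrightarrow> x + h \<in> T"
  using T by auto

lemma T_nonneg: "0 \<le> x \<Longrightarrow> x \<in> T"
  using T by auto

lemma T_upward: "a \<in> T \<Longrightarrow> a \<le> x \<Longrightarrow> x \<in> T"
  using T by auto

lemma T_Icc: "a \<in> T \<Longrightarrow> {a..b} \<subseteq> T"
  using T by auto

text \<open>This allows the two time sets to be treated alike: a window is always a compact
  interval, and only its left end depends on \<open>T\<close>.\<close>

lemma window_obtain:
  assumes "0 < l"
  obtains a where "T \<inter> {-l..l} = {a..l}" "-l \<le> a" "a \<le> 0" "a \<in> T"
proof -
  have "T \<inter> {-l..l} = {0..l}" if "T = {0..}" using that assms by auto
  moreover have "T \<inter> {-l..l} = {-l..l}" if "T = UNIV" using that by auto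
  ultimately show ?thesis using T that[of 0] that[of "-l"] assms by auto
qed

text \<open>Windows anchored at 0 are exchanged for arbitrary intervals inside \<open>T\<close>, a
  form stable under translation, and extended integrals for gauge integrals.\<close>

lemma Lp_loc_fun_iff:
  "f \<in> Lp_loc_fun p T \<longleftrightarrow> strongly_measurable (lebesgue_on T) f \<and>
     (\<forall>a b. {a..b} \<subseteq> T \<longrightarrow> (\<lambda>x. norm (f x) powr p) integrable_on {a..b})" (is "_ \<longleftrightarrow> ?m \<and> ?i")
proof (intro iffI conjI)
  assume f: "f \<in> Lp_loc_fun p T"
  then show m: ?m by (simp add: Lp_loc_fun_def)
  show ?i
  proof (intro allI impI)
    fix a b assume ab: "{a..b} \<subseteq> T"
    define l where "l = max 1 (max \<bar>a\<bar> \<bar>b\<bar>)"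
    have "0 < l" by (simp add: l_def)
    have "strongly_measurable (lebesgue_on (T \<inter> {-l..l})) f"
      by (rule strongly_measurable_subset[OF _ _ _ m]) auto
    then have [measurable]: "(\<lambda>x. norm (f x)) \<in> borel_measurable (lebesgue_on (T \<inter> {-l..l}))"
      by (rule strongly_measurable_norm[rotated]) auto
    have "(\<lambda>x. norm (f x) powr p) integrable_on (T \<inter> {-l..l})"
      using f \<open>0 < l\<close> by (intro nonneg_measurable_integrable_on) (auto simp: Lp_loc_fun_def)
    moreover have "{a..b} \<subseteq> T \<inter> {-l..l}" using ab by (auto simp: l_def)
    ultimately show "(\<lambda>x. norm (f x) powr p) integrable_on {a..b}"
      by (rule integrable_on_subinterval)
  qed
next
  assume a: "?m \<and> ?i"
  have "(\<integral>\<^sup>+x. ennreal (norm (f x) powr p) \<partial>lebesgue_on (T \<inter> {-l..l})) < \<infinity>" if "0 < l" for l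
  proof -
    obtain b where b: "T \<inter> {-l..l} = {b..l}" using window_obtain[OF \<open>0 < l\<close>] by metis
    then have "(\<lambda>x. norm (f x) powr p) integrable_on {b..l}" using a by blast
    then show ?thesis unfolding b by (subst nonneg_integrable_on_nn_integral) auto
  qed
  then show "f \<in> Lp_loc_fun p T" using a by (auto simp: Lp_loc_fun_def)
qed

lemma Lp_loc_fun_measurable:
  assumes "f \<in> Lp_loc_fun p T" "{a..b} \<subseteq> T"
  shows "strongly_measurable (lebesgue_on {a..b}) f"
  by (rule strongly_measurable_subset[of T]) (use assms in \<open>auto simp: Lp_loc_fun_def\<close>)

lemma Lp_loc_fun_diff:
  assumes "f \<in> Lp_loc_fun p T" "g \<in> Lp_loc_fun p T"
  shows "(\<lambda>x. f x - g x) \<in> Lp_loc_fun p T"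
  unfolding Lp_loc_fun_iff
proof (intro conjI allI impI)
  show "strongly_measurable (lebesgue_on T) (\<lambda>x. f x - g x)"
    using assms by (intro strongly_measurable_diff) (auto simp: Lp_loc_fun_def)
  fix a b assume ab: "{a..b} \<subseteq> T"
  let ?c = "(1/2) powr (1 - p) :: real"
  have [measurable]: "(\<lambda>x. norm (f x - g x)) \<in> borel_measurable (lebesgue_on {a..b})"
    by (intro strongly_measurable_norm strongly_measurable_diff Lp_loc_fun_measurable assms ab) simp
  show "(\<lambda>x. norm (f x - g x) powr p) integrable_on {a..b}"
  proof (rule measurable_bounded_by_integrable_imp_integrable)
    show "(\<lambda>x. ?c * norm (f x) powr p + ?c * norm (g x) powr p) integrable_on {a..b}"
      using assms ab unfolding Lp_loc_fun_iff
      by (intro Henstock_Kurzweil_Integration.integrable_add integrable_on_mult_right) auto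
    fix x
    have "norm (f x - g x) powr p \<le> (norm (f x) + norm (g x)) powr p"
      using p by (intro powr_mono2 norm_triangle_ineq4) auto
    also have "\<dots> \<le> ?c * norm (f x) powr p + ?c * norm (g x) powr p"
      using powr_add_le[OF p, of "norm (f x)" "norm (g x)" "1/2"] by simp
    finally show "norm (norm (f x - g x) powr p) \<le> ?c * norm (f x) powr p + ?c * norm (g x) powr p"
      by simp
  qed (measurable, simp)
qed

lemma Lp_loc_fun_shift:
  assumes "f \<in> Lp_loc_fun p T" "h \<in> T"
  shows "(\<lambda>x. f (x + h)) \<in> Lp_loc_fun p T"
  unfolding Lp_loc_fun_iff
proof (intro conjI allI impI)
  show "strongly_measurable (lebesgue_on T) (\<lambda>x. f (x + h))"
    using assms T_add by (intro strongly_measurable_shift[of T]) (auto simp: Lp_loc_fun_def)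
  fix a b assume ab: "{a..b} \<subseteq> T"
  show "(\<lambda>x. norm (f (x + h)) powr p) integrable_on {a..b}"
  proof (cases "a \<le> b")
    case True
    then have "{a + h..b + h} \<subseteq> T" using ab assms(2) by (intro T_Icc T_add) auto
    then have "(\<lambda>x. norm (f x) powr p) integrable_on {a + h..b + h}"
      using assms(1) unfolding Lp_loc_fun_iff by blast
    from integrable_shift_real_ivl[OF this, of h] show ?thesis by simp
  qed (simp add: integrable_on_empty)
qed

lemma rho_integrable:
  assumes "f \<in> Lp_loc_fun p T" "g \<in> Lp_loc_fun p T" "{a..b} \<subseteq> T"
  shows "(\<lambda>x. norm (f x - g x) powr p) integrable_on {a..b}"
  using Lp_loc_fun_diff[OF assms(1,2)] assms(3) unfolding Lp_loc_fun_iff by blast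

text \<open>In the non-integrable case this rests on the convention that the integral is then
  0.\<close>

lemma rho_nonneg: "0 \<le> rho p S f g"
  unfolding rho_def by (cases "(\<lambda>x. norm (f x - g x) powr p) integrable_on S")
    (simp_all add: Henstock_Kurzweil_Integration.integral_nonneg not_integrable_integral)

lemma rho_mono:
  assumes "f \<in> Lp_loc_fun p T" "g \<in> Lp_loc_fun p T" "{a..b} \<subseteq> {a'..b'}" "{a'..b'} \<subseteq> T"
  shows "rho p {a..b} f g \<le> rho p {a'..b'} f g"
  unfolding rho_def using assms by (intro integral_subset_le rho_integrable) auto

lemma rho_triangle:
  assumes "f \<in> Lp_loc_fun p T" "g \<in> Lp_loc_fun p T" "h \<in> Lp_loc_fun p T" "{a..b} \<subseteq> T"
    and "0 < \<theta>" "\<theta> < 1"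
  shows "rho p {a..b} f h \<le> (1 - \<theta>) powr (1 - p) * rho p {a..b} f g + \<theta> powr (1 - p) * rho p {a..b} g h"
proof -
  have "rho p {a..b} f h \<le> integral {a..b} (\<lambda>x. (1 - \<theta>) powr (1 - p) * norm (f x - g x) powr p
      + \<theta> powr (1 - p) * norm (g x - h x) powr p)"
    unfolding rho_def
  proof (intro integral_le rho_integrable assms Henstock_Kurzweil_Integration.integrable_add integrable_on_mult_right)
    fix x
    have "norm (f x - h x) powr p \<le> (norm (f x - g x) + norm (g x - h x)) powr p"
      using p by (intro powr_mono2 norm_diff_triangle_le[OF order_refl order_refl]) auto
    also have "\<dots> \<le> (1 - \<theta>) powr (1 - p) * norm (f x - g x) powr p + \<theta> powr (1 - p) * norm (g x - h x) powr p"
      using assms by (intro powr_add_le p) auto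
    finally show "norm (f x - h x) powr p
        \<le> (1 - \<theta>) powr (1 - p) * norm (f x - g x) powr p + \<theta> powr (1 - p) * norm (g x - h x) powr p" .
  qed
  also have "\<dots> = (1 - \<theta>) powr (1 - p) * rho p {a..b} f g + \<theta> powr (1 - p) * rho p {a..b} g h"
    unfolding rho_def using assms
    by (subst Henstock_Kurzweil_Integration.integral_add)
       (auto intro!: integrable_on_mult_right rho_integrable)
  finally show ?thesis .
qed

lemma Lp_loc_fun_L1:
  assumes "f \<in> Lp_loc_fun p T" "{a..b} \<subseteq> T"
  shows "(\<lambda>x. norm (f x)) integrable_on {a..b}"
proof (rule measurable_bounded_by_integrable_imp_integrable)
  show "(\<lambda>x. norm (f x)) \<in> borel_measurable (lebesgue_on {a..b})"
    by (intro strongly_measurable_norm Lp_loc_fun_measurable assms) simp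
  show "(\<lambda>x. 1 + norm (f x) powr p) integrable_on {a..b}"
    using assms unfolding Lp_loc_fun_iff
    by (intro Henstock_Kurzweil_Integration.integrable_add) auto
  show "norm (norm (f x)) \<le> 1 + norm (f x) powr p" for x
    using le_add_powr[OF p, of 1 "norm (f x)"] by simp
qed simp

text \<open>The parameter \<eta> is at the caller's disposal: as soon as the L^p term
  \<open>rho\<close> is below \<open>\<eta> powr p\<close>, the right-hand side is below
  \<open>(K + 1) * \<eta>\<close>.\<close>

lemma L1_le_rho:
  assumes "f \<in> Lp_loc_fun p T" "g \<in> Lp_loc_fun p T" "{0..K} \<subseteq> T" "0 < \<eta>" "0 \<le> K"
  shows "integral {0..K} (\<lambda>x. norm (f x - g x)) \<le> K * \<eta> + \<eta> powr (1 - p) * rho p {0..K} f g"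
proof -
  have "integral {0..K} (\<lambda>x. norm (f x - g x))
      \<le> integral {0..K} (\<lambda>x. \<eta> + \<eta> powr (1 - p) * norm (f x - g x) powr p)"
  proof (rule integral_le)
    show "(\<lambda>x. norm (f x - g x)) integrable_on {0..K}"
      using Lp_loc_fun_L1[OF Lp_loc_fun_diff[OF assms(1,2)] assms(3)] .
    show "(\<lambda>x. \<eta> + \<eta> powr (1 - p) * norm (f x - g x) powr p) integrable_on {0..K}"
      using rho_integrable[OF assms(1-3)]
      by (intro Henstock_Kurzweil_Integration.integrable_add integrable_on_mult_right) auto
  qed (use le_add_powr[OF p assms(4)] in auto)
  also have "\<dots> = integral {0..K} (\<lambda>x. \<eta>) + \<eta> powr (1 - p) * rho p {0..K} f g"
    unfolding rho_def using assms
    using rho_integrable[OF assms(1-3)]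
    by (subst Henstock_Kurzweil_Integration.integral_add) (auto intro!: integrable_on_mult_right)
  finally show ?thesis using assms by simp
qed

lemma Lp_loc_fun_integrable:
  assumes "f \<in> Lp_loc_fun p T" "{a..b} \<subseteq> T"
  shows "f integrable_on {a..b}" "strong_integral (lebesgue_on {a..b}) f = integral {a..b} f"
  using strong_integral_eq_integral[OF Lp_loc_fun_measurable[OF assms] Lp_loc_fun_L1[OF assms]] .

text \<open>On a window starting at a \<le> 0 both branches of \<open>primitive\<close> are the
  indefinite integral from a minus one constant, so no separate argument at 0 arises. Continuity is
  local, and the window around t contains a neighbourhood of t in \<open>T\<close>.\<close>

lemma primitive_continuous:
  assumes "f \<in> Lp_loc_fun p T"
  shows "continuous_on T (primitive f)"
proof -
  have on: "continuous_on {a..b} (primitive f)" if "a \<in> T" "a \<le> 0" for a b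
  proof -
    have i: "f integrable_on {c..d}" if "a \<le> c" for c d
    proof (rule Lp_loc_fun_integrable(1)[OF assms])
      show "{c..d} \<subseteq> T"
        by (rule T_Icc[OF T_upward[OF \<open>a \<in> T\<close> that]])
    qed
    have eq: "primitive f t = integral {a..t} f - integral {a..0} f" if "t \<in> {a..b}" for t
    proof (cases "0 \<le> t")
      case True
      then have "primitive f t = integral {0..t} f"
        using Lp_loc_fun_integrable(2)[OF assms T_Icc[OF T_nonneg]] by (simp add: primitive_def)
      moreover have "integral {a..0} f + integral {0..t} f = integral {a..t} f"
        using True \<open>a \<le> 0\<close> by (intro Henstock_Kurzweil_Integration.integral_combine i) auto
      ultimately show ?thesis by (metis add_diff_cancel_left')
    next
      case False
      have "t \<in> T" using that by (intro T_upward[OF \<open>a \<in> T\<close>]) simp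
      with False have "primitive f t = - integral {t..0} f"
        using Lp_loc_fun_integrable(2)[OF assms T_Icc] by (simp add: primitive_def)
      moreover have "integral {a..t} f + integral {t..0} f = integral {a..0} f"
        using False that by (intro Henstock_Kurzweil_Integration.integral_combine i) auto
      ultimately show ?thesis by (metis add_diff_cancel_left' minus_diff_eq)
    qed
    have "continuous_on {a..b} (\<lambda>t. integral {a..t} f - integral {a..0} f)"
      by (intro continuous_intros indefinite_integral_continuous_1 i) simp
    then show ?thesis by (rule continuous_on_eq) (simp add: eq)
  qed
  show ?thesis
    unfolding continuous_on_eq_continuous_within
  proof
    fix t assume "t \<in> T"
    obtain a where a: "T \<inter> {-(\<bar>t\<bar> + 1)..\<bar>t\<bar> + 1} = {a..\<bar>t\<bar> + 1}" "a \<le> 0" "a \<in> T"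
      using window_obtain[of "\<bar>t\<bar> + 1"] by (metis abs_ge_zero add_nonneg_pos zero_less_one)
    have "continuous (at t within T \<inter> {-(\<bar>t\<bar> + 1)..\<bar>t\<bar> + 1}) (primitive f)"
      using on[OF a(3,2), of "\<bar>t\<bar> + 1"] \<open>t \<in> T\<close> unfolding a(1)[symmetric] continuous_on_eq_continuous_within
      by (auto simp: abs_if split: if_splits)
    moreover have "at t within T \<inter> {-(\<bar>t\<bar> + 1)..\<bar>t\<bar> + 1} = at t within T"
      by (rule at_within_nhd[of t "{-(\<bar>t\<bar> + 1)<..<\<bar>t\<bar> + 1}"]) auto
    ultimately show "continuous (at t within T) (primitive f)" by simp
  qed
qed

lemma locally_integrable_Lp:
  assumes "f \<in> Lp_loc_fun p T"
  shows "locally_integrable f"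
proof
  fix t s K :: real assume "0 \<le> t" "0 \<le> s"
  have "(\<lambda>u. f (u + t)) \<in> Lp_loc_fun p T" "(\<lambda>u. f (u + s)) \<in> Lp_loc_fun p T"
    using Lp_loc_fun_shift[OF assms T_nonneg[OF \<open>0 \<le> t\<close>]]
      Lp_loc_fun_shift[OF assms T_nonneg[OF \<open>0 \<le> s\<close>]] .
  from Lp_loc_fun_diff[OF this] have "(\<lambda>u. f (t + u) - f (s + u)) \<in> Lp_loc_fun p T"
    by (simp add: add.commute)
  then show "(\<lambda>u. norm (f (t + u) - f (s + u))) integrable_on {0..K}"
    by (rule Lp_loc_fun_L1[OF _ T_Icc[OF T_nonneg]]) simp
qed (use assms in \<open>auto intro!: Lp_loc_fun_integrable T_nonneg\<close>)

end
section \<open>The topology of local \<open>L\<^sup>p\<close> convergence\<close>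

lemma Lp_class_cong:
  assumes "AE x in lebesgue_on T. f x = g x"
  shows "Lp_class p T f = Lp_class p T g"
proof -
  have "(AE x in lebesgue_on T. h x = f x) \<longleftrightarrow> (AE x in lebesgue_on T. h x = g x)" for h
  proof
    assume "AE x in lebesgue_on T. h x = f x"
    then show "AE x in lebesgue_on T. h x = g x" using assms by eventually_elim simp
  next
    assume "AE x in lebesgue_on T. h x = g x"
    then show "AE x in lebesgue_on T. h x = f x" using assms by eventually_elim simp
  qed
  then show ?thesis by (auto simp: Lp_class_def)
qed

context Lp_space
begin

lemma Lp_class_self: "f \<in> Lp_loc_fun p T \<Longrightarrow> f \<in> Lp_class p T f"
  by (simp add: Lp_class_def)

lemma Lp_class_eq_iff:
  assumes "f \<in> Lp_loc_fun p T"
  shows "Lp_class p T f = Lp_class p T g \<longleftrightarrow> (AE x in lebesgue_on T. f x = g x)"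
  using Lp_class_cong[where f = f and g = g] Lp_class_self[OF assms] by (auto simp: Lp_class_def)

text \<open>Translates of null sets are null, so every representative contributes the same class and
  the union collapses.\<close>

lemma Lp_shift_class:
  assumes "f \<in> Lp_loc_fun p T" "h \<in> T"
  shows "Lp_shift p T h (Lp_class p T f) = Lp_class p T (\<lambda>x. f (x + h))"
proof -
  have "Lp_class p T (\<lambda>x. g (x + h)) = Lp_class p T (\<lambda>x. f (x + h))" if "g \<in> Lp_class p T f" for g
    using that assms(2) T_add
    by (intro Lp_class_cong AE_lebesgue_on_shift[of T T]) (auto simp: Lp_class_def)
  then show ?thesis
    unfolding Lp_shift_def using Lp_class_self[OF assms(1)] by blast
qed

definition pdist :: "real \<Rightarrow> (real \<Rightarrow> 'a::banach) \<Rightarrow> (real \<Rightarrow> 'a) \<Rightarrow> real" where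
  "pdist l f g = rho p (T \<inter> {-l..l}) f g"

text \<open>This is \<open>2 powr (p - 1)\<close>, the common value of both coefficients of the
  weighted triangle inequality at \<theta> = 1/2.\<close>

definition triangle_const :: real where
  "triangle_const = (1/2) powr (1 - p)"

lemma triangle_const_pos: "0 < triangle_const"
  by (simp add: triangle_const_def)

lemma pdist_nonneg: "0 \<le> pdist l f g"
  by (simp add: pdist_def rho_nonneg)

lemma pdist_commute: "pdist l f g = pdist l g f"
  by (simp add: pdist_def rho_commute)

lemma pdist_mono:
  assumes "f \<in> Lp_loc_fun p T" "g \<in> Lp_loc_fun p T" "0 < l" "l \<le> l'"
  shows "pdist l f g \<le> pdist l' f g"
proof -
  obtain a a' where a: "T \<inter> {-l..l} = {a..l}" "T \<inter> {-l'..l'} = {a'..l'}"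
    using window_obtain[of l] window_obtain[of l'] assms by (metis less_le_trans)
  have "{a..l} \<subseteq> {a'..l'}" unfolding a[symmetric] using assms by auto
  moreover have "{a'..l'} \<subseteq> T" unfolding a[symmetric] by auto
  ultimately show ?thesis unfolding pdist_def a using assms by (intro rho_mono) auto
qed

lemma pdist_triangle:
  assumes "f \<in> Lp_loc_fun p T" "g \<in> Lp_loc_fun p T" "h \<in> Lp_loc_fun p T" "0 < l" "0 < \<theta>" "\<theta> < 1"
  shows "pdist l f h \<le> (1 - \<theta>) powr (1 - p) * pdist l f g + \<theta> powr (1 - p) * pdist l g h"
proof -
  obtain a where a: "T \<inter> {-l..l} = {a..l}" using window_obtain[OF \<open>0 < l\<close>] by metis
  then have "{a..l} \<subseteq> T" by blast
  then show ?thesis unfolding pdist_def a using assms by (intro rho_triangle)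
qed

lemma pdist_quasi_triangle:
  assumes "f \<in> Lp_loc_fun p T" "g \<in> Lp_loc_fun p T" "h \<in> Lp_loc_fun p T" "0 < l"
  shows "pdist l f h \<le> triangle_const * (pdist l f g + pdist l g h)"
  using pdist_triangle[OF assms, of "1/2"] by (simp add: triangle_const_def algebra_simps)

lemma pdist_shift:
  assumes "f \<in> Lp_loc_fun p T" "g \<in> Lp_loc_fun p T" "0 < l" "h \<in> T"
  shows "pdist l (\<lambda>x. f (x + h)) (\<lambda>x. g (x + h)) \<le> pdist (l + \<bar>h\<bar>) f g"
proof -
  obtain a where a: "T \<inter> {-l..l} = {a..l}" "-l \<le> a" "a \<in> T"
    using window_obtain[OF \<open>0 < l\<close>] by metis
  obtain a' where a': "T \<inter> {-(l + \<bar>h\<bar>)..l + \<bar>h\<bar>} = {a'..l + \<bar>h\<bar>}"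
    using window_obtain[of "l + \<bar>h\<bar>"] assms(3) by (metis abs_ge_zero add_pos_nonneg)
  have "{a + h..l + h} \<subseteq> T \<inter> {-(l + \<bar>h\<bar>)..l + \<bar>h\<bar>}"
    using T_Icc[OF T_add[OF a(3) assms(4)]] a(2) by auto
  then show ?thesis
    unfolding pdist_def a(1) rho_shift a' using assms a' by (intro rho_mono) auto
qed

lemma rho_le_pdist:
  assumes "f \<in> Lp_loc_fun p T" "g \<in> Lp_loc_fun p T" "0 < l"
  shows "rho p {0..l} f g \<le> pdist l f g"
proof -
  obtain a where a: "T \<inter> {-l..l} = {a..l}" "a \<le> 0"
    using window_obtain[OF \<open>0 < l\<close>] by metis
  then have "{a..l} \<subseteq> T" by blast
  then show ?thesis unfolding pdist_def a(1) using assms a(2) by (intro rho_mono) auto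
qed

lemma pdist_AE_cong:
  assumes "AE x in lebesgue_on T. f x = f' x"
  shows "pdist l f g = pdist l f' g"
proof -
  have "AE x in lebesgue. x \<in> T \<longrightarrow> f x = f' x"
    using assms by (simp add: AE_restrict_space_iff)
  then obtain N where "negligible N" "{x. \<not> (x \<in> T \<longrightarrow> f x = f' x)} \<subseteq> N"
    unfolding eventually_ae_filter_negligible by blast
  then show ?thesis
    unfolding pdist_def rho_def by (intro integral_spike[of N]) auto
qed

text \<open>The seminorms separate points: the windows of radius \<open>Suc n\<close> exhaust
  \<open>T\<close>, and countably many null sets have a null union.\<close>

lemma pdist_zero_imp_AE:
  assumes "f \<in> Lp_loc_fun p T" "g \<in> Lp_loc_fun p T" "\<And>l. 0 < l \<Longrightarrow> pdist l f g = 0"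
  shows "AE x in lebesgue_on T. f x = g x"
proof -
  have "AE x in lebesgue. x \<in> T \<inter> {-real (Suc n)..real (Suc n)} \<longrightarrow> f x = g x" for n
  proof -
    obtain a where a: "T \<inter> {-real (Suc n)..real (Suc n)} = {a..real (Suc n)}"
      using window_obtain[of "real (Suc n)"] by (metis of_nat_0_less_iff zero_less_Suc)
    then have aT: "{a..real (Suc n)} \<subseteq> T" by blast
    have "integral {a..real (Suc n)} (\<lambda>x. norm (f x - g x) powr p) = 0"
      using assms(3)[of "real (Suc n)"] unfolding pdist_def rho_def a by simp
    then have z: "(\<integral>\<^sup>+x. ennreal (norm (f x - g x) powr p) \<partial>lebesgue_on {a..real (Suc n)}) = 0"
      by (subst nonneg_integrable_on_nn_integral) (use rho_integrable[OF assms(1,2) aT] in auto)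
    have [measurable]: "(\<lambda>x. norm (f x - g x)) \<in> borel_measurable (lebesgue_on {a..real (Suc n)})"
      by (intro strongly_measurable_norm strongly_measurable_diff Lp_loc_fun_measurable assms aT) simp
    have "(\<lambda>x. ennreal (norm (f x - g x) powr p)) \<in> borel_measurable (lebesgue_on {a..real (Suc n)})"
      by measurable
    from nn_integral_0_iff_AE[OF this] z have "AE x in lebesgue_on {a..real (Suc n)}. ennreal (norm (f x - g x) powr p) = 0"
      by blast
    then have "AE x in lebesgue_on {a..real (Suc n)}. f x = g x"
      by eventually_elim (simp add: ennreal_eq_0_iff)
    then show ?thesis unfolding a by (simp add: AE_restrict_space_iff)
  qed
  then have "AE x in lebesgue. \<forall>n. x \<in> T \<inter> {-real (Suc n)..real (Suc n)} \<longrightarrow> f x = g x"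
    by (subst AE_all_countable) auto
  then have "AE x in lebesgue. x \<in> T \<longrightarrow> f x = g x"
  proof eventually_elim
    case (elim x)
    show ?case
    proof
      assume "x \<in> T"
      obtain n :: nat where "\<bar>x\<bar> \<le> real n" using real_arch_simple by blast
      then have "x \<in> T \<inter> {-real (Suc n)..real (Suc n)}" using \<open>x \<in> T\<close> by auto
      with elim show "f x = g x" by blast
    qed
  qed
  then show ?thesis by (simp add: AE_restrict_space_iff)
qed

lemma Lp_seminorm_less_iff:
  assumes "f \<in> Lp_loc_fun p T" "g \<in> Lp_loc_fun p T" "0 < l" "0 < e"
  shows "Lp_seminorm p T l (\<lambda>s. f s - g s) < e \<longleftrightarrow> pdist l f g < e powr p"
proof -
  obtain a where a: "T \<inter> {-l..l} = {a..l}" using window_obtain[OF \<open>0 < l\<close>] by metis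
  then have "{a..l} \<subseteq> T" by blast
  then have "(\<lambda>s. norm (f s - g s) powr p) absolutely_integrable_on {a..l}"
    using assms by (intro nonnegative_absolutely_integrable_1 rho_integrable) auto
  then have "integrable (lebesgue_on {a..l}) (\<lambda>s. norm (f s - g s) powr p)"
    by (rule absolutely_integrable_imp_integrable) simp
  then have "integral\<^sup>L (lebesgue_on {a..l}) (\<lambda>s. norm (f s - g s) powr p) = pdist l f g"
    unfolding pdist_def rho_def a by (rule lebesgue_integral_eq_integral) simp
  then have eq: "Lp_seminorm p T l (\<lambda>s. f s - g s) = pdist l f g powr (1 / p)"
    unfolding Lp_seminorm_def a by simp
  have "pdist l f g = (pdist l f g powr (1 / p)) powr p"
    using p pdist_nonneg[of l f g] by (simp add: powr_powr)
  moreover have "x powr p < e powr p \<longleftrightarrow> x < e" if "0 \<le> x" for x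
    using that p assms(4) powr_less_mono2[of p x e] powr_mono2[of p e x] by (meson less_le not_less order_less_le_trans zero_less_one)
  ultimately show ?thesis unfolding eq by (metis powr_ge_zero)
qed

definition Lp_ball :: "real \<Rightarrow> (real \<Rightarrow> 'a::banach) \<Rightarrow> real \<Rightarrow> (real \<Rightarrow> 'a) set set" where
  "Lp_ball l f e = Lp_class p T ` {g \<in> Lp_loc_fun p T. pdist l g f < e}"

lemma Lp_class_mem_ball:
  assumes "g \<in> Lp_loc_fun p T"
  shows "Lp_class p T g \<in> Lp_ball l f e \<longleftrightarrow> pdist l g f < e"
  using assms pdist_AE_cong[of g _ l f] by (auto simp: Lp_ball_def Lp_class_eq_iff)

text \<open>The map e to \<open>e powr p\<close> permutes the positive radii, so measuring balls by
  \<open>pdist\<close> yields the same generating family.\<close>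

lemma Lp_loc_basis:
  "{Lp_class p T ` {g \<in> Lp_loc_fun p T. Lp_seminorm p T l (\<lambda>s. g s - f s) < e} | f l e.
      f \<in> Lp_loc_fun p T \<and> 0 < l \<and> 0 < e} =
   {Lp_ball l f e | f l e. f \<in> (Lp_loc_fun p T :: (real \<Rightarrow> 'a::banach) set) \<and> 0 < l \<and> 0 < e}"
  (is "?L = ?R")
proof -
  have eq: "Lp_class p T ` {g \<in> Lp_loc_fun p T. Lp_seminorm p T l (\<lambda>s. g s - f s) < e} = Lp_ball l f (e powr p)"
    if "f \<in> Lp_loc_fun p T" "0 < l" "0 < e" for f :: "real \<Rightarrow> 'a" and l e
    unfolding Lp_ball_def using that by (intro arg_cong[where f = "image _"]) (auto simp: Lp_seminorm_less_iff)
  show ?thesis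
  proof (intro equalityI subsetI)
    fix X assume "X \<in> ?L"
    then obtain f l e where f: "f \<in> Lp_loc_fun p T" "0 < l" "0 < e"
      and "X = Lp_class p T ` {g \<in> Lp_loc_fun p T. Lp_seminorm p T l (\<lambda>s. g s - f s) < e}"
      by blast
    then have "X = Lp_ball l f (e powr p)" "0 < e powr p" using eq[OF f] by simp_all
    then show "X \<in> ?R" using f by blast
  next
    fix X assume "X \<in> ?R"
    then obtain f l e where f: "f \<in> Lp_loc_fun p T" "0 < l" "0 < e" "X = Lp_ball l f e"
      by blast
    have e: "e = (e powr (1 / p)) powr p" "0 < e powr (1 / p)" using f(3) p by (simp_all add: powr_powr)
    have "X = Lp_class p T ` {g \<in> Lp_loc_fun p T. Lp_seminorm p T l (\<lambda>s. g s - f s) < e powr (1 / p)}"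
      unfolding eq[OF f(1,2) e(2)] e(1)[symmetric] by (rule f(4))
    then show "X \<in> ?L" using f(1,2) e(2) by blast
  qed
qed

lemma openin_Lp_ball:
  assumes "f \<in> Lp_loc_fun p T" "0 < l" "0 < e"
  shows "openin (Lp_loc p T) (Lp_ball l f e)"
  unfolding Lp_loc_def Lp_loc_basis using assms by (intro topology_generated_by_Basis) blast

lemma topspace_Lp_loc: "topspace (Lp_loc p T) = Lp_class p T ` Lp_loc_fun p T"
proof -
  have ball: "Lp_class p T f \<in> Lp_ball 1 f 1" if "f \<in> Lp_loc_fun p T" for f :: "real \<Rightarrow> 'a"
    using that by (auto simp: Lp_class_mem_ball pdist_def rho_def)
  then show ?thesis
    unfolding Lp_loc_def Lp_loc_basis topology_generated_by_topspace
  proof (intro equalityI subsetI)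
    fix x assume "x \<in> Lp_class p T ` (Lp_loc_fun p T :: (real \<Rightarrow> 'a) set)"
    then obtain f where "f \<in> Lp_loc_fun p T" "x = Lp_class p T f" by blast
    then show "x \<in> \<Union>{Lp_ball l f e | f l e. f \<in> Lp_loc_fun p T \<and> 0 < l \<and> 0 < e}"
      using ball[of f] by (intro UnionI[of "Lp_ball 1 f 1"]) (auto intro!: exI[of _ f] exI[of _ 1])
  qed (auto simp: Lp_ball_def)
qed

text \<open>The quasi-triangle inequality with its constant \<open>triangle_const\<close> would be
  too lossy, as f may lie close to the boundary of the ball around g. A small \<theta> brings the
  coefficient of \<open>pdist l f g\<close> so near to 1 that the sum still fits below e.\<close>

lemma Lp_ball_absorbs:
  assumes "f \<in> Lp_loc_fun p T" "g \<in> Lp_loc_fun p T" "0 < l" "pdist l f g < e"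
  obtains \<delta> where "0 < \<delta>" "Lp_ball l f \<delta> \<subseteq> Lp_ball l g e"
proof -
  have "((\<lambda>\<theta>. (1 - \<theta>) powr (1 - p) * pdist l f g) \<longlongrightarrow> (1 - 0) powr (1 - p) * pdist l f g) (at_right 0)"
    by (intro tendsto_intros) auto
  then have "\<forall>\<^sub>F \<theta> in at_right 0. (1 - \<theta>) powr (1 - p) * pdist l f g < e"
    using assms(4) by (intro order_tendstoD(2)) auto
  moreover have "\<forall>\<^sub>F \<theta> in at_right (0::real). 0 < \<theta> \<and> \<theta> < 1"
    using eventually_at_right_real[of 0 "1::real"] by simp
  ultimately have "\<forall>\<^sub>F \<theta> in at_right 0. (1 - \<theta>) powr (1 - p) * pdist l f g < e \<and> 0 < \<theta> \<and> \<theta> < 1"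
    by eventually_elim simp
  then obtain \<theta> where \<theta>: "(1 - \<theta>) powr (1 - p) * pdist l f g < e" "0 < \<theta>" "\<theta> < 1"
    using eventually_happens'[OF trivial_limit_at_right_real] by blast
  \<comment> \<open>The room left below e, divided by the coefficient with which the new distance
    enters.\<close>
  define \<delta> where "\<delta> = (e - (1 - \<theta>) powr (1 - p) * pdist l f g) / \<theta> powr (1 - p)"
  show thesis
  proof
    show "0 < \<delta>" using \<theta> by (simp add: \<delta>_def)
    have "pdist l h g < e" if h: "h \<in> Lp_loc_fun p T" "pdist l h f < \<delta>" for h
    proof -
      have "pdist l g h \<le> (1 - \<theta>) powr (1 - p) * pdist l g f + \<theta> powr (1 - p) * pdist l f h"
        using assms h \<theta> by (intro pdist_triangle) auto
      also have "\<theta> powr (1 - p) * pdist l f h < \<theta> powr (1 - p) * \<delta>"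
        using h(2) \<theta> by (simp add: pdist_commute)
      also have "\<theta> powr (1 - p) * \<delta> = e - (1 - \<theta>) powr (1 - p) * pdist l f g"
        using \<theta> by (simp add: \<delta>_def)
      finally show ?thesis by (simp add: pdist_commute)
    qed
    then show "Lp_ball l f \<delta> \<subseteq> Lp_ball l g e" by (auto simp: Lp_ball_def)
  qed
qed

text \<open>The balls are given only as a subbase. Finite intersections are handled by the larger
  window and the smaller radius, and \<open>Lp_ball_absorbs\<close> recentres a generating ball at
  f.\<close>

lemma openin_Lp_loc_contains_ball:
  assumes "openin (Lp_loc p T) U" "f \<in> Lp_loc_fun p T" "Lp_class p T f \<in> U"
  shows "\<exists>l>0. \<exists>e>0. Lp_ball l f e \<subseteq> U"
proof -
  have "generate_topology_on {Lp_ball l f e | f l e. f \<in> Lp_loc_fun p T \<and> 0 < l \<and> 0 < e} U"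
    using assms(1) unfolding Lp_loc_def Lp_loc_basis by (rule openin_topology_generated_by)
  then show ?thesis using assms(3)
  proof induction
    case Empty
    then show ?case by simp
  next
    case (Int a b)
    then obtain l1 e1 l2 e2 where 1: "0 < l1" "0 < e1" "Lp_ball l1 f e1 \<subseteq> a"
      and 2: "0 < l2" "0 < e2" "Lp_ball l2 f e2 \<subseteq> b" by auto
    have "Lp_ball (max l1 l2) f (min e1 e2) \<subseteq> Lp_ball l1 f e1 \<inter> Lp_ball l2 f e2"
    proof
      fix x assume "x \<in> Lp_ball (max l1 l2) f (min e1 e2)"
      then obtain g where g: "x = Lp_class p T g" "g \<in> Lp_loc_fun p T" "pdist (max l1 l2) g f < min e1 e2"
        by (auto simp: Lp_ball_def)
      then show "x \<in> Lp_ball l1 f e1 \<inter> Lp_ball l2 f e2"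
        using pdist_mono[OF g(2) assms(2) 1(1), of "max l1 l2"] pdist_mono[OF g(2) assms(2) 2(1), of "max l1 l2"]
        by (simp add: Lp_class_mem_ball)
    qed
    then show ?case using 1 2 by (intro exI[of _ "max l1 l2"] conjI exI[of _ "min e1 e2"]) auto
  next
    case (UN K)
    then show ?case by blast
  next
    case (Basis s)
    then obtain g l e where s: "s = Lp_ball l g e" and g: "g \<in> Lp_loc_fun p T" "0 < l" by blast
    then have "pdist l f g < e" using Basis.prems assms(2) by (simp add: Lp_class_mem_ball)
    from Lp_ball_absorbs[OF assms(2) g this] show ?case unfolding s using g(2) by metis
  qed
qed

lemma limitin_Lp_loc:
  assumes "f \<in> Lp_loc_fun p T" "\<And>k. g k \<in> Lp_loc_fun p T"
    and "\<And>l e. 0 < l \<Longrightarrow> 0 < e \<Longrightarrow> \<forall>\<^sub>F k in sequentially. pdist l (g k) f < e"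
  shows "limitin (Lp_loc p T) (\<lambda>k. Lp_class p T (g k)) (Lp_class p T f) sequentially"
  unfolding limitin_def
proof (intro conjI allI impI)
  show "Lp_class p T f \<in> topspace (Lp_loc p T)"
    using assms(1) by (simp add: topspace_Lp_loc)
  fix U assume "openin (Lp_loc p T) U \<and> Lp_class p T f \<in> U"
  then obtain l e where le: "0 < l" "0 < e" "Lp_ball l f e \<subseteq> U"
    using openin_Lp_loc_contains_ball assms(1) by blast
  show "\<forall>\<^sub>F k in sequentially. Lp_class p T (g k) \<in> U"
    using assms(3)[OF le(1,2)]
  proof eventually_elim
    case (elim k)
    then have "Lp_class p T (g k) \<in> Lp_ball l f e" using assms(2) by (simp add: Lp_class_mem_ball)
    then show ?case using le(3) by blast
  qed
qed

section \<open>Limit points of the orbit\<close>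

lemma pdist_add_shift:
  assumes "\<phi> \<in> Lp_loc_fun p T" "u \<in> T" "g \<in> Lp_loc_fun p T" "0 < l" "h \<in> T"
  shows "pdist l (\<lambda>x. \<phi> (x + (u + h))) (\<lambda>x. g (x + h)) \<le> pdist (l + \<bar>h\<bar>) (\<lambda>x. \<phi> (x + u)) g"
  using pdist_shift[OF Lp_loc_fun_shift[OF assms(1,2)] assms(3,4,5)] by (simp add: add_ac)

text \<open>Otherwise each f has a ball that the translates avoid from some index \<open>N f\<close>
  on. Finitely many such balls cover the closure of the orbit, and the translate at an index beyond
  all these thresholds lies in none of them.\<close>

lemma Lagrange_stable_cluster:
  fixes \<phi> :: "real \<Rightarrow> 'a::banach"
  assumes \<phi>: "\<phi> \<in> Lp_loc_fun p T"
    and stable: "pos_Lagrange_stable (Lp_loc p T) (Lp_shift p T) (Lp_class p T \<phi>)"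
    and u: "\<And>k::nat. 0 \<le> u k"
  obtains f where "f \<in> Lp_loc_fun p T"
    "\<And>l e N. 0 < l \<Longrightarrow> 0 < e \<Longrightarrow> \<exists>k\<ge>N. pdist l (\<lambda>x. \<phi> (x + u k)) f < e"
proof (rule ccontr)
  note cluster = that
  assume contra: "\<not> thesis"
  let ?X = "Lp_loc p T :: (real \<Rightarrow> 'a) set topology"
  let ?S = "?X closure_of ((\<lambda>h. Lp_shift p T h (Lp_class p T \<phi>)) ` {0..})"
  have "\<exists>l e N. 0 < l \<and> 0 < e \<and> (\<forall>k\<ge>N. e \<le> pdist l (\<lambda>x. \<phi> (x + u k)) f)"
    if f: "f \<in> Lp_loc_fun p T" for f
  proof (rule ccontr)
    assume far: "\<not> ?thesis"
    have "\<exists>k\<ge>N. pdist l (\<lambda>x. \<phi> (x + u k)) f < e" if le: "0 < l" "0 < e" for l e N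
    proof (rule ccontr)
      assume "\<not> ?thesis"
      then have "\<forall>k\<ge>N. e \<le> pdist l (\<lambda>x. \<phi> (x + u k)) f" by (simp add: not_less)
      with le far show False by blast
    qed
    with contra cluster[OF f] show False by blast
  qed
  then obtain l e N where 1: "\<And>f. f \<in> Lp_loc_fun p T \<Longrightarrow> 0 < l f" "\<And>f. f \<in> Lp_loc_fun p T \<Longrightarrow> 0 < e f"
    and far: "\<And>f k. f \<in> Lp_loc_fun p T \<Longrightarrow> k \<ge> N f \<Longrightarrow> e f \<le> pdist (l f) (\<lambda>x. \<phi> (x + u k)) f"
    by metis
  let ?U = "(\<lambda>f. Lp_ball (l f) f (e f)) ` Lp_loc_fun p T"
  have "compactin ?X ?S"
    using stable by (simp add: pos_Lagrange_stable_def)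
  moreover have "?S \<subseteq> \<Union>?U"
  proof
    fix c assume "c \<in> ?S"
    then have "c \<in> topspace ?X" by (rule subsetD[OF closure_of_subset_topspace])
    then obtain f where f: "f \<in> Lp_loc_fun p T" "c = Lp_class p T f" by (auto simp: topspace_Lp_loc)
    then have "c \<in> Lp_ball (l f) f (e f)"
      using 1[OF f(1)] by (simp add: Lp_class_mem_ball pdist_def rho_def)
    then show "c \<in> \<Union>?U" using f(1) by blast
  qed
  moreover have "\<forall>V\<in>?U. openin ?X V" using 1 openin_Lp_ball by blast
  ultimately obtain \<F> where "finite \<F>" "\<F> \<subseteq> ?U" "?S \<subseteq> \<Union>\<F>"
    unfolding compactin_def by meson
  then obtain K where K: "K \<subseteq> Lp_loc_fun p T" "finite K" "\<F> = (\<lambda>f. Lp_ball (l f) f (e f)) ` K"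
    by (meson finite_subset_image)
  \<comment> \<open>The inserted 0 gives \<open>Max\<close> a nonempty argument even if
    \<open>K\<close> is empty.\<close>
  define k where "k = Max (insert 0 (N ` K))"
  have k: "N f \<le> k" if "f \<in> K" for f
    unfolding k_def using that K(2) by (intro Max_ge) auto
  have "(\<lambda>h. Lp_shift p T h (Lp_class p T \<phi>)) ` {0..} \<subseteq> topspace ?X"
    using \<phi> by (auto simp: Lp_shift_class T_nonneg topspace_Lp_loc intro!: imageI Lp_loc_fun_shift[OF \<phi>])
  then have "(\<lambda>h. Lp_shift p T h (Lp_class p T \<phi>)) ` {0..} \<subseteq> ?S"
    by (rule closure_of_subset)
  then have "Lp_shift p T (u k) (Lp_class p T \<phi>) \<in> ?S" using u[of k] by auto
  then have "Lp_class p T (\<lambda>x. \<phi> (x + u k)) \<in> \<Union>\<F>"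
    using \<open>?S \<subseteq> \<Union>\<F>\<close> Lp_shift_class[OF \<phi> T_nonneg[OF u[of k]]] by auto
  then obtain f where "f \<in> K" "Lp_class p T (\<lambda>x. \<phi> (x + u k)) \<in> Lp_ball (l f) f (e f)"
    using K(3) by auto
  then have "pdist (l f) (\<lambda>x. \<phi> (x + u k)) f < e f"
    using Lp_loc_fun_shift[OF \<phi> T_nonneg[OF u[of k]]] by (simp add: Lp_class_mem_ball)
  moreover have "e f \<le> pdist (l f) (\<lambda>x. \<phi> (x + u k)) f"
    using far[of f k] k \<open>f \<in> K\<close> K(1) by auto
  ultimately show False by simp
qed

text \<open>Formulated for functions and not for classes, so that distances can be taken directly;
  \<open>G B\<close> is the set of admissible times at stage B.\<close>

definition limit_points :: "(real \<Rightarrow> 'a::banach) \<Rightarrow> (real \<Rightarrow> real set) \<Rightarrow> (real \<Rightarrow> 'a) set" where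
  "limit_points \<phi> G = {f \<in> Lp_loc_fun p T.
     \<forall>l e B. 0 < l \<longrightarrow> 0 < e \<longrightarrow> (\<exists>u\<in>G B. pdist l (\<lambda>x. \<phi> (x + u)) f < e)}"

text \<open>
  The limit points along an escaping family of sets of times form a nonempty closed invariant
  subset of the \<open>\<omega>\<close>-limit set.  Minimality is exploited by choosing the family at will.
\<close>

definition escaping :: "(real \<Rightarrow> real set) \<Rightarrow> bool" where
  "escaping G \<longleftrightarrow> (\<forall>B. G B \<noteq> {} \<and> G B \<subseteq> {B..} \<and> (\<forall>B'\<ge>B. G B' \<subseteq> G B) \<and>
     (\<forall>h. \<forall>u\<in>G (B + \<bar>h\<bar>). u + h \<in> G B))"

lemma
  assumes "escaping G"
  shows escaping_nonempty: "G B \<noteq> {}"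
    and escaping_ge: "u \<in> G B \<Longrightarrow> B \<le> u"
    and escaping_antimono: "u \<in> G B' \<Longrightarrow> B \<le> B' \<Longrightarrow> u \<in> G B"
    and escaping_shift: "u \<in> G (B + \<bar>h\<bar>) \<Longrightarrow> u + h \<in> G B"
proof -
  note e = assms[unfolded escaping_def, rule_format]
  show "G B \<noteq> {}" using e[of B] by blast
  show "u \<in> G B \<Longrightarrow> B \<le> u" using e[of B] by auto
  show "u \<in> G B' \<Longrightarrow> B \<le> B' \<Longrightarrow> u \<in> G B" using e[of B] by blast
  show "u \<in> G (B + \<bar>h\<bar>) \<Longrightarrow> u + h \<in> G B" using e[of B] by blast
qed

lemma limit_points_Lp: "f \<in> limit_points \<phi> G \<Longrightarrow> f \<in> Lp_loc_fun p T"
  by (simp add: limit_points_def)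

lemma limit_points_approx:
  assumes "f \<in> limit_points \<phi> G" "0 < l" "0 < e"
  obtains u where "u \<in> G B" "pdist l (\<lambda>x. \<phi> (x + u)) f < e"
  using assms unfolding limit_points_def by blast

text \<open>A diagonal choice, with window k+1 and accuracy 1/(k+1) at stage k. The offset c
  reserves room for moving the times back later.\<close>

lemma limit_points_sequence:
  assumes "\<phi> \<in> Lp_loc_fun p T" "f \<in> limit_points \<phi> G" "escaping G"
  shows "\<exists>u :: nat \<Rightarrow> real. (\<forall>k. u k \<in> G (real k + c) \<and> real k + c \<le> u k) \<and>
    (\<forall>l>0. \<forall>e>0. \<forall>\<^sub>F k in sequentially. pdist l (\<lambda>x. \<phi> (x + u k)) f < e)"
proof -
  have "\<exists>u\<in>G (real k + c). pdist (real (Suc k)) (\<lambda>x. \<phi> (x + u)) f < 1 / real (Suc k)" for k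
    using assms(2) by (simp add: limit_points_def)
  then obtain u where u: "\<And>k. u k \<in> G (real k + c)"
    "\<And>k. pdist (real (Suc k)) (\<lambda>x. \<phi> (x + u k)) f < 1 / real (Suc k)" by metis
  have ge: "real k + c \<le> u k" for k
    by (rule escaping_ge[OF assms(3) u(1)])
  show ?thesis
  proof (rule exI[of _ u], intro conjI allI impI u(1) ge)
    fix l e :: real assume "0 < l" "0 < e"
    have "\<forall>\<^sub>F k in sequentially. l \<le> real k" "\<forall>\<^sub>F k in sequentially. -c \<le> real k"
      "\<forall>\<^sub>F k in sequentially. 1 / e \<le> real k"
      using filterlim_real_sequentially by (auto simp: filterlim_at_top)
    then show "\<forall>\<^sub>F k in sequentially. pdist l (\<lambda>x. \<phi> (x + u k)) f < e"
    proof eventually_elim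
      case (elim k)
      have "0 \<le> u k" using ge[of k] elim by simp
      have "pdist l (\<lambda>x. \<phi> (x + u k)) f \<le> pdist (real (Suc k)) (\<lambda>x. \<phi> (x + u k)) f"
        using assms(2) elim \<open>0 < l\<close> Lp_loc_fun_shift[OF assms(1) T_nonneg[OF \<open>0 \<le> u k\<close>]]
        by (intro pdist_mono) (auto simp: limit_points_def)
      also have "\<dots> < 1 / real (Suc k)" by (rule u)
      also have "\<dots> \<le> e" using elim(3) \<open>0 < e\<close> by (simp add: field_simps)
      finally show ?case .
    qed
  qed
qed

lemma escaping_atLeast: "escaping atLeast"
  by (auto simp: escaping_def)

lemma limit_points_subset:
  assumes "escaping G"
  shows "limit_points \<phi> G \<subseteq> limit_points \<phi> atLeast"
proof
  fix f assume f: "f \<in> limit_points \<phi> G"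
  have "\<exists>u\<in>{B..}. pdist l (\<lambda>x. \<phi> (x + u)) f < e" if le: "0 < l" "0 < e" for l e B
  proof -
    obtain u where u: "u \<in> G B" "pdist l (\<lambda>x. \<phi> (x + u)) f < e"
      by (rule limit_points_approx[OF f le])
    have "u \<in> {B..}" using escaping_ge[OF assms u(1)] by simp
    then show ?thesis using u(2) by blast
  qed
  with f show "f \<in> limit_points \<phi> atLeast" by (simp add: limit_points_def)
qed

lemma limit_points_in_omega:
  assumes "\<phi> \<in> Lp_loc_fun p T" "f \<in> limit_points \<phi> atLeast"
  shows "Lp_class p T f \<in> omega_limit_set T (Lp_loc p T) (Lp_shift p T) (Lp_class p T \<phi>)"
proof -
  obtain u :: "nat \<Rightarrow> real" where u: "\<And>k. real k + 0 \<le> u k"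
    and lim: "\<And>l e. 0 < l \<Longrightarrow> 0 < e \<Longrightarrow> \<forall>\<^sub>F k in sequentially. pdist l (\<lambda>x. \<phi> (x + u k)) f < e"
    using limit_points_sequence[OF assms escaping_atLeast, of 0] by blast
  have u0: "0 \<le> u k" for k using u[of k] of_nat_0_le_iff[of k] by linarith
  have uT: "u k \<in> T" for k by (rule T_nonneg[OF u0])
  have "filterlim u at_top sequentially"
    using u by (intro filterlim_at_top_mono[OF filterlim_real_sequentially]) auto
  moreover have "limitin (Lp_loc p T) (\<lambda>k. Lp_class p T (\<lambda>x. \<phi> (x + u k))) (Lp_class p T f) sequentially"
  proof (rule limitin_Lp_loc)
    show "f \<in> Lp_loc_fun p T" using assms(2) by (simp add: limit_points_def)
    show "(\<lambda>x. \<phi> (x + u k)) \<in> Lp_loc_fun p T" for k by (rule Lp_loc_fun_shift[OF assms(1) uT])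
    show "\<forall>\<^sub>F k in sequentially. pdist l (\<lambda>x. \<phi> (x + u k)) f < e" if "0 < l" "0 < e" for l e
      by (rule lim[OF that])
  qed
  ultimately show ?thesis
    unfolding omega_limit_set_def using uT Lp_shift_class[OF assms(1) uT]
    by (auto intro!: exI[of _ u])
qed

lemma closedin_limit_points:
  assumes "\<phi> \<in> Lp_loc_fun p T" "escaping G"
  shows "closedin (Lp_loc p T) (Lp_class p T ` limit_points \<phi> G)"
  unfolding closedin_def
proof
  let ?M = "Lp_class p T ` limit_points \<phi> G"
  show "?M \<subseteq> topspace (Lp_loc p T)"
    by (auto simp: topspace_Lp_loc limit_points_def)
  have "\<exists>V. openin (Lp_loc p T) V \<and> c \<in> V \<and> V \<subseteq> topspace (Lp_loc p T) - ?M"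
    if c: "c \<in> topspace (Lp_loc p T) - ?M" for c
  proof -
    obtain f where f: "f \<in> Lp_loc_fun p T" "c = Lp_class p T f" "f \<notin> limit_points \<phi> G"
      using c unfolding topspace_Lp_loc by blast
    then obtain l e B where le: "0 < l" "0 < e"
      and far: "\<And>u. u \<in> G B \<Longrightarrow> e \<le> pdist l (\<lambda>x. \<phi> (x + u)) f"
      unfolding limit_points_def by (auto simp: not_less)
    define e' where "e' = e / (2 * triangle_const)"
    have "0 < e'" using le triangle_const_pos by (simp add: e'_def)
    have "g \<notin> limit_points \<phi> G" if g: "g \<in> Lp_loc_fun p T" "pdist l g f < e'" for g
    proof
      assume "g \<in> limit_points \<phi> G"
      \<comment> \<open>The maximum with 0 makes u nonnegative, so that translation by u is
        legitimate also when \<open>T\<close> is the half-line.\<close>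
      then obtain u where u: "u \<in> G (max B 0)" "pdist l (\<lambda>x. \<phi> (x + u)) g < e'"
        by (rule limit_points_approx[OF _ le(1) \<open>0 < e'\<close>])
      have "0 \<le> u" "u \<in> G B"
        using escaping_ge[OF assms(2) u(1)] escaping_antimono[OF assms(2) u(1), of B] by auto
      have "pdist l (\<lambda>x. \<phi> (x + u)) f \<le> triangle_const * (pdist l (\<lambda>x. \<phi> (x + u)) g + pdist l g f)"
        using le f g Lp_loc_fun_shift[OF assms(1) T_nonneg[OF \<open>0 \<le> u\<close>]] by (intro pdist_quasi_triangle)
      also have "\<dots> < triangle_const * (e' + e')"
        using triangle_const_pos u(2) g(2) by (intro mult_strict_left_mono add_strict_mono)
      also have "\<dots> = e" using triangle_const_pos by (simp add: e'_def)
      finally show False using far[OF \<open>u \<in> G B\<close>] by simp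
    qed
    then have "Lp_ball l f e' \<subseteq> topspace (Lp_loc p T) - ?M"
    proof (intro subsetI)
      fix c assume not: "\<And>g. g \<in> Lp_loc_fun p T \<Longrightarrow> pdist l g f < e' \<Longrightarrow> g \<notin> limit_points \<phi> G"
        and c: "c \<in> Lp_ball l f e'"
      have "c \<notin> ?M"
      proof
        assume "c \<in> ?M"
        then obtain g where "g \<in> limit_points \<phi> G" "c = Lp_class p T g" by blast
        moreover from this have "g \<in> Lp_loc_fun p T" by (simp add: limit_points_def)
        ultimately show False using c not[of g] by (simp add: Lp_class_mem_ball)
      qed
      then show "c \<in> topspace (Lp_loc p T) - ?M" using c by (auto simp: topspace_Lp_loc Lp_ball_def)
    qed
    moreover have "c \<in> Lp_ball l f e'"
      using f \<open>0 < e'\<close> by (simp add: Lp_class_mem_ball pdist_def rho_def)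
    ultimately show ?thesis using openin_Lp_ball[OF f(1) le(1) \<open>0 < e'\<close>] by blast
  qed
  then show "openin (Lp_loc p T) (topspace (Lp_loc p T) - ?M)"
    by (subst openin_subopen) blast
qed

lemma limit_points_shift:
  assumes "\<phi> \<in> Lp_loc_fun p T" "escaping G" "f \<in> limit_points \<phi> G" "h \<in> T"
  shows "(\<lambda>x. f (x + h)) \<in> limit_points \<phi> G"
  unfolding limit_points_def
proof (intro CollectI conjI allI impI)
  have f: "f \<in> Lp_loc_fun p T" using assms(3) by (simp add: limit_points_def)
  then show "(\<lambda>x. f (x + h)) \<in> Lp_loc_fun p T" using assms(4) by (rule Lp_loc_fun_shift)
  fix l e B :: real assume "0 < l" "0 < e"
  \<comment> \<open>The shift by h is paid for twice: with a later stage of \<open>G\<close>, and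
    with a larger window.\<close>
  obtain u where u: "u \<in> G (max B 0 + \<bar>h\<bar>)" "pdist (l + \<bar>h\<bar>) (\<lambda>x. \<phi> (x + u)) f < e"
  proof (rule limit_points_approx[OF assms(3)])
    show "0 < l + \<bar>h\<bar>" using \<open>0 < l\<close> by simp
  qed (rule \<open>0 < e\<close>)
  have "0 \<le> u" using escaping_ge[OF assms(2) u(1)] by simp
  have "u + h \<in> G B"
    using escaping_antimono[OF assms(2) escaping_shift[OF assms(2) u(1)], of B] by simp
  have "pdist l (\<lambda>x. \<phi> (x + (u + h))) (\<lambda>x. f (x + h)) < e"
    using pdist_add_shift[OF assms(1) T_nonneg[OF \<open>0 \<le> u\<close>] f \<open>0 < l\<close> assms(4)] u(2) by simp
  then show "\<exists>u\<in>G B. pdist l (\<lambda>x. \<phi> (x + u)) (\<lambda>x. f (x + h)) < e"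
    using \<open>u + h \<in> G B\<close> by blast
qed

lemma limit_points_cluster:
  assumes "\<phi> \<in> Lp_loc_fun p T" "escaping G"
    and "pos_Lagrange_stable (Lp_loc p T) (Lp_shift p T) (Lp_class p T \<phi>)"
    and "\<And>k::nat. w k \<in> G (real k)"
  obtains g where "g \<in> limit_points \<phi> G"
    "\<And>l e N. 0 < l \<Longrightarrow> 0 < e \<Longrightarrow> \<exists>k\<ge>N. pdist l (\<lambda>x. \<phi> (x + w k)) g < e"
proof -
  have "0 \<le> w k" for k using escaping_ge[OF assms(2) assms(4)[of k]] by simp
  then obtain g where g: "g \<in> Lp_loc_fun p T"
    "\<And>l e N. 0 < l \<Longrightarrow> 0 < e \<Longrightarrow> \<exists>k\<ge>N. pdist l (\<lambda>x. \<phi> (x + w k)) g < e"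
    using Lagrange_stable_cluster[OF assms(1,3)] by metis
  have "\<exists>u\<in>G B. pdist l (\<lambda>x. \<phi> (x + u)) g < e" if "0 < l" "0 < e" for l e B
  proof -
    obtain k where k: "k \<ge> nat \<lceil>B\<rceil>" "pdist l (\<lambda>x. \<phi> (x + w k)) g < e" using g(2) \<open>0 < l\<close> \<open>0 < e\<close> by blast
    have "B \<le> real k" using k(1) by linarith
    then have "w k \<in> G B" by (rule escaping_antimono[OF assms(2) assms(4)])
    then show ?thesis using k(2) by blast
  qed
  with g(1) have "g \<in> limit_points \<phi> G" by (simp add: limit_points_def)
  then show thesis using g(2) by (rule that)
qed

text \<open>Invariance is an equality, and on the half-line a shift need not be invertible. A
  preimage of f under the shift by h comes from compactness: times approximating f are moved back by
  h, and the translates there have a cluster point g, whose shift by h is f almost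
  everywhere.\<close>

lemma invariant_limit_points:
  assumes "\<phi> \<in> Lp_loc_fun p T" "escaping G"
    and "pos_Lagrange_stable (Lp_loc p T) (Lp_shift p T) (Lp_class p T \<phi>)"
  shows "invariant_set T (Lp_shift p T) (Lp_class p T ` limit_points \<phi> G)"
  unfolding invariant_set_def
proof (intro ballI equalityI subsetI)
  fix h c assume h: "h \<in> T" and "c \<in> Lp_shift p T h ` Lp_class p T ` limit_points \<phi> G"
  then obtain f where f: "f \<in> limit_points \<phi> G" "c = Lp_shift p T h (Lp_class p T f)" by blast
  then have "f \<in> Lp_loc_fun p T" by (simp add: limit_points_def)
  with f(2) h have "c = Lp_class p T (\<lambda>x. f (x + h))" by (simp add: Lp_shift_class)
  then show "c \<in> Lp_class p T ` limit_points \<phi> G"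
    using limit_points_shift[OF assms(1,2) f(1) h] by blast
next
  fix h c assume h: "h \<in> T" and "c \<in> Lp_class p T ` limit_points \<phi> G"
  then obtain f where f: "f \<in> limit_points \<phi> G" "c = Lp_class p T f" by blast
  then have fL: "f \<in> Lp_loc_fun p T" by (simp add: limit_points_def)
  obtain u :: "nat \<Rightarrow> real" where u: "\<And>k. u k \<in> G (real k + \<bar>h\<bar>)" "\<And>k. real k + \<bar>h\<bar> \<le> u k"
    and lim: "\<And>l e. 0 < l \<Longrightarrow> 0 < e \<Longrightarrow> \<forall>\<^sub>F k in sequentially. pdist l (\<lambda>x. \<phi> (x + u k)) f < e"
    using limit_points_sequence[OF assms(1) f(1) assms(2), of "\<bar>h\<bar>"] by blast
  have w: "u k + (-h) \<in> G (real k)" for k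
    using escaping_shift[OF assms(2), of "u k" "real k" "-h"] u(1)[of k] by simp
  obtain g where g: "g \<in> limit_points \<phi> G"
    "\<And>l e N. 0 < l \<Longrightarrow> 0 < e \<Longrightarrow> \<exists>k\<ge>N. pdist l (\<lambda>x. \<phi> (x + (u k + (-h)))) g < e"
    by (rule limit_points_cluster[OF assms w]) (rule that; blast)
  then have gL: "g \<in> Lp_loc_fun p T" by (simp add: limit_points_def)
  have gh: "(\<lambda>x. g (x + h)) \<in> Lp_loc_fun p T" using gL h by (rule Lp_loc_fun_shift)
  have uh: "u k + (-h) \<in> T" "u k \<in> T" for k
    using u(2)[of k] abs_ge_self[of h] abs_ge_zero[of h] by (intro T_nonneg; linarith)+
  have "pdist l f (\<lambda>x. g (x + h)) = 0" if "0 < l" for l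
  proof (rule ccontr)
    assume "pdist l f (\<lambda>x. g (x + h)) \<noteq> 0"
    then have pos: "0 < pdist l f (\<lambda>x. g (x + h))" using pdist_nonneg[of l f "\<lambda>x. g (x + h)"] by simp
    define e where "e = pdist l f (\<lambda>x. g (x + h)) / (2 * triangle_const)"
    have "0 < e" using pos triangle_const_pos by (simp add: e_def)
    obtain N where N: "\<And>k. k \<ge> N \<Longrightarrow> pdist l (\<lambda>x. \<phi> (x + u k)) f < e"
      using lim[OF \<open>0 < l\<close> \<open>0 < e\<close>] by (auto simp: eventually_sequentially)
    have "0 < l + \<bar>h\<bar>" using \<open>0 < l\<close> by simp
    from g(2)[OF this \<open>0 < e\<close>] obtain k where k: "k \<ge> N" "pdist (l + \<bar>h\<bar>) (\<lambda>x. \<phi> (x + (u k + (-h)))) g < e"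
      by blast
    have "pdist l (\<lambda>x. \<phi> (x + u k)) (\<lambda>x. g (x + h)) < e"
      using pdist_add_shift[OF assms(1) uh(1)[of k] gL \<open>0 < l\<close> h] k(2) by simp
    moreover have "pdist l f (\<lambda>x. \<phi> (x + u k)) < e"
      using N[OF k(1)] by (simp add: pdist_commute)
    ultimately have "triangle_const * (pdist l f (\<lambda>x. \<phi> (x + u k)) + pdist l (\<lambda>x. \<phi> (x + u k)) (\<lambda>x. g (x + h))) < triangle_const * (e + e)"
      using triangle_const_pos by (intro mult_strict_left_mono add_strict_mono)
    moreover have "triangle_const * (e + e) = pdist l f (\<lambda>x. g (x + h))" using triangle_const_pos by (simp add: e_def)
    ultimately show False
      using pdist_quasi_triangle[OF fL Lp_loc_fun_shift[OF assms(1) uh(2)[of k]] gh \<open>0 < l\<close>] by simp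
  qed
  then have "Lp_class p T f = Lp_class p T (\<lambda>x. g (x + h))"
    by (intro Lp_class_cong pdist_zero_imp_AE fL gh)
  then have "c = Lp_shift p T h (Lp_class p T g)"
    using f(2) Lp_shift_class[OF gL h] by simp
  then show "c \<in> Lp_shift p T h ` Lp_class p T ` limit_points \<phi> G" using g(1) by blast
qed

lemma minimal_omega_limit_points:
  assumes "\<phi> \<in> Lp_loc_fun p T" "escaping G"
    and "pos_Lagrange_stable (Lp_loc p T) (Lp_shift p T) (Lp_class p T \<phi>)"
    and min: "minimal_set T (Lp_loc p T) (Lp_shift p T)
      (omega_limit_set T (Lp_loc p T) (Lp_shift p T) (Lp_class p T \<phi>))"
    and f: "f \<in> limit_points \<phi> atLeast"
  shows "f \<in> limit_points \<phi> G"
proof -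
  let ?M = "Lp_class p T ` limit_points \<phi> G"
  let ?Y = "omega_limit_set T (Lp_loc p T) (Lp_shift p T) (Lp_class p T \<phi>)"
  have "?M \<subseteq> ?Y"
    using limit_points_in_omega[OF assms(1)] limit_points_subset[OF assms(2)] by blast
  moreover have "?M \<noteq> {}"
  proof -
    have "\<exists>w. \<forall>k::nat. w k \<in> G (real k)"
      using escaping_nonempty[OF assms(2)] by (intro choice) blast
    then show ?thesis using limit_points_cluster[OF assms(1-3)] by (metis empty_iff image_is_empty)
  qed
  ultimately have "?M = ?Y"
    using min closedin_limit_points[OF assms(1,2)] invariant_limit_points[OF assms(1-3)]
    unfolding minimal_set_def by blast
  moreover have "Lp_class p T f \<in> ?Y"
    using limit_points_in_omega[OF assms(1) f] .
  ultimately obtain g where g: "g \<in> limit_points \<phi> G" "Lp_class p T f = Lp_class p T g" by auto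
  have fL: "f \<in> Lp_loc_fun p T" using f by (simp add: limit_points_def)
  then have "AE x in lebesgue_on T. f x = g x" using g(2) by (simp add: Lp_class_eq_iff)
  \<comment> \<open>Equality of classes yields f = g only almost everywhere, a difference that
    \<open>pdist\<close> does not see.\<close>
  then have "pdist l (\<lambda>x. \<phi> (x + u)) f = pdist l (\<lambda>x. \<phi> (x + u)) g" for l u
    using pdist_AE_cong[of f g l "\<lambda>x. \<phi> (x + u)"] by (simp add: pdist_commute)
  then show ?thesis using g(1) fL by (simp add: limit_points_def)
qed

section \<open>From minimality to uniform recurrence of the orbit\<close>

text \<open>If no n works, ever longer intervals [t n, t n + n] contain no time at which \<phi>
  resembles its translate by \<open>s n\<close>. A cluster point \<psi> of these translates lies in
  the \<omega>-limit set, so minimality forces it to be approximated along times inside such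
  intervals, a contradiction. One number n serves both as bound on the return time and as starting
  threshold.\<close>

lemma bounded_return_time:
  assumes \<phi>: "\<phi> \<in> Lp_loc_fun p T"
    and stable: "pos_Lagrange_stable (Lp_loc p T) (Lp_shift p T) (Lp_class p T \<phi>)"
    and min: "minimal_set T (Lp_loc p T) (Lp_shift p T)
      (omega_limit_set T (Lp_loc p T) (Lp_shift p T) (Lp_class p T \<phi>))"
    and K: "0 < K" and \<eta>: "0 < \<eta>"
  obtains n :: nat where "\<And>t s. real n \<le> t \<Longrightarrow> real n \<le> s \<Longrightarrow>
    \<exists>h. 0 \<le> h \<and> h \<le> real n \<and> pdist K (\<lambda>x. \<phi> (x + (t + h))) (\<lambda>x. \<phi> (x + s)) < \<eta>"
proof (rule ccontr)
  note return = that
  assume contra: "\<not> thesis"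
  have "\<exists>t s. real n \<le> t \<and> real n \<le> s \<and>
      (\<forall>h. 0 \<le> h \<longrightarrow> h \<le> real n \<longrightarrow> \<eta> \<le> pdist K (\<lambda>x. \<phi> (x + (t + h))) (\<lambda>x. \<phi> (x + s)))" for n
  proof (rule ccontr)
    assume "\<not> ?thesis"
    then have "\<exists>h. 0 \<le> h \<and> h \<le> real n \<and> pdist K (\<lambda>x. \<phi> (x + (t + h))) (\<lambda>x. \<phi> (x + s)) < \<eta>"
      if "real n \<le> t" "real n \<le> s" for t s
      using that by (meson not_less)
    with contra return show False by blast
  qed
  then obtain t s where ts: "\<And>n. real n \<le> t n" "\<And>n. real n \<le> s n"
    and far: "\<And>n h. 0 \<le> h \<Longrightarrow> h \<le> real n \<Longrightarrow> \<eta> \<le> pdist K (\<lambda>x. \<phi> (x + (t n + h))) (\<lambda>x. \<phi> (x + s n))"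
    by metis
  have s_in: "s n \<in> {real n..}" for n using ts(2) by simp
  obtain \<psi> where \<psi>: "\<psi> \<in> limit_points \<phi> atLeast"
    and cluster: "\<And>l e N. 0 < l \<Longrightarrow> 0 < e \<Longrightarrow> \<exists>k\<ge>N. pdist l (\<lambda>x. \<phi> (x + s k)) \<psi> < e"
    by (rule limit_points_cluster[OF \<phi> escaping_atLeast stable s_in]) (rule that; blast)
  define \<eta>' where "\<eta>' = \<eta> / (2 * triangle_const)"
  have "0 < \<eta>'" using \<eta> triangle_const_pos by (simp add: \<eta>'_def)
  define J where "J = {n. pdist K (\<lambda>x. \<phi> (x + s n)) \<psi> < \<eta>'}"
  \<comment> \<open>Times in the interval [t n, t n + n] at distance at least B from both ends, for
    B \<ge> 0. Keeping away from the ends leaves room for shifts in both directions;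
    \<open>2 * B \<le> n\<close> leaves something in the middle. Restricting n to \<open>J\<close>
    keeps only indices whose translate by \<open>s n\<close> is already close to \<psi>.\<close>
  define G where "G B = {u. \<exists>n\<in>J. t n + B \<le> u \<and> u + B \<le> t n + real n}" for B
  have "escaping G"
    unfolding escaping_def
  proof (intro allI conjI ballI impI)
    fix B :: real
    obtain n where n: "n \<ge> nat \<lceil>2 * B\<rceil>" "pdist K (\<lambda>x. \<phi> (x + s n)) \<psi> < \<eta>'"
      using cluster[OF K \<open>0 < \<eta>'\<close>] by blast
    then have "2 * B \<le> real n" by linarith
    then have "t n + B \<in> G B" using n(2) by (auto simp: G_def J_def intro!: bexI[of _ n])
    then show "G B \<noteq> {}" by blast
    show "G B \<subseteq> {B..}"
    proof
      fix u assume "u \<in> G B"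
      then obtain n where "t n + B \<le> u" by (auto simp: G_def)
      then show "u \<in> {B..}" using ts(1)[of n] of_nat_0_le_iff[of n] by simp
    qed
    show "G B' \<subseteq> G B" if "B \<le> B'" for B'
    proof
      fix u assume "u \<in> G B'"
      then obtain n where "n \<in> J" "t n + B' \<le> u" "u + B' \<le> t n + real n" by (auto simp: G_def)
      then show "u \<in> G B" using that unfolding G_def by (intro CollectI bexI[of _ n]) auto
    qed
    fix h u assume "u \<in> G (B + \<bar>h\<bar>)"
    then obtain n where n: "n \<in> J" "t n + (B + \<bar>h\<bar>) \<le> u" "u + (B + \<bar>h\<bar>) \<le> t n + real n"
      by (auto simp: G_def)
    have "t n + B \<le> u + h" "u + h + B \<le> t n + real n"
      using n(2,3) abs_ge_self[of h] abs_ge_minus_self[of h] by linarith+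
    then show "u + h \<in> G B" using n(1) by (auto simp: G_def)
  qed
  then have "\<psi> \<in> limit_points \<phi> G"
    by (rule minimal_omega_limit_points[OF \<phi> _ stable min \<psi>])
  then obtain u where u: "u \<in> G 0" "pdist K (\<lambda>x. \<phi> (x + u)) \<psi> < \<eta>'"
    by (rule limit_points_approx[OF _ K \<open>0 < \<eta>'\<close>])
  then obtain n where n: "n \<in> J" "t n \<le> u" "u \<le> t n + real n" by (auto simp: G_def)
  have L: "(\<lambda>x. \<phi> (x + u)) \<in> Lp_loc_fun p T" "(\<lambda>x. \<phi> (x + s n)) \<in> Lp_loc_fun p T"
    using ts(1)[of n] ts(2)[of n] n(2) of_nat_0_le_iff[of n]
    by (intro Lp_loc_fun_shift[OF \<phi> T_nonneg]; linarith)+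
  have "pdist K (\<lambda>x. \<phi> (x + u)) (\<lambda>x. \<phi> (x + s n))
      \<le> triangle_const * (pdist K (\<lambda>x. \<phi> (x + u)) \<psi> + pdist K \<psi> (\<lambda>x. \<phi> (x + s n)))"
    by (rule pdist_quasi_triangle[OF L(1) limit_points_Lp[OF \<psi>] L(2) K])
  also have "\<dots> < triangle_const * (\<eta>' + \<eta>')"
    using triangle_const_pos u(2) n(1) by (intro mult_strict_left_mono add_strict_mono) (auto simp: J_def pdist_commute)
  also have "\<dots> = \<eta>" using triangle_const_pos by (simp add: \<eta>'_def)
  finally show False using far[of "u - t n" n] n(2,3) by simp
qed

lemma d_le_rho:
  assumes "\<phi> \<in> Lp_loc_fun p T" "0 \<le> t" "0 \<le> s" "0 \<le> K" "0 < \<eta>"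
  shows "locally_integrable.d \<phi> K t s
    \<le> K * \<eta> + \<eta> powr (1 - p) * rho p {0..K} (\<lambda>x. \<phi> (x + t)) (\<lambda>x. \<phi> (x + s))"
proof -
  interpret locally_integrable \<phi> by (rule locally_integrable_Lp[OF assms(1)])
  show ?thesis
    using L1_le_rho[OF Lp_loc_fun_shift[OF assms(1) T_nonneg[OF assms(2)]]
        Lp_loc_fun_shift[OF assms(1) T_nonneg[OF assms(3)]] T_Icc[OF T_nonneg] assms(5,4)]
    by (simp add: d_def add.commute)
qed

lemma uniformly_recurrent_minimal:
  assumes \<phi>: "\<phi> \<in> Lp_loc_fun p T"
    and stable: "pos_Lagrange_stable (Lp_loc p T) (Lp_shift p T) (Lp_class p T \<phi>)"
    and min: "minimal_set T (Lp_loc p T) (Lp_shift p T)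
      (omega_limit_set T (Lp_loc p T) (Lp_shift p T) (Lp_class p T \<phi>))"
  shows "locally_integrable.uniformly_recurrent \<phi>"
proof -
  interpret locally_integrable \<phi> by (rule locally_integrable_Lp[OF \<phi>])
  show ?thesis
    unfolding uniformly_recurrent_def
  proof (intro allI impI)
    fix K \<eta> :: real assume "0 \<le> K" "0 < \<eta>"
    \<comment> \<open>The window is enlarged to \<open>K + 1\<close> because
      \<open>bounded_return_time\<close> asks for a positive length while \<open>K\<close> may be 0.
      Of the \<open>K + 2\<close> shares, \<open>K + 1\<close> go to the linear term of
      \<open>d_le_rho\<close> and one to its \<open>rho\<close> term.\<close>
    define \<eta>1 where "\<eta>1 = \<eta> / (K + 2)"
    have "(K + 2) * \<eta>1 = \<eta>" "0 < \<eta>1"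
      using \<open>0 < \<eta>\<close> \<open>0 \<le> K\<close> by (auto simp: \<eta>1_def)
    then have \<eta>1: "0 < \<eta>1" "(K + 1) * \<eta>1 + \<eta>1 = \<eta>" by (auto simp: algebra_simps)
    obtain n :: nat where n: "\<And>t s. real n \<le> t \<Longrightarrow> real n \<le> s \<Longrightarrow>
        \<exists>h. 0 \<le> h \<and> h \<le> real n \<and>
          pdist (K + 1) (\<lambda>x. \<phi> (x + (t + h))) (\<lambda>x. \<phi> (x + s)) < \<eta>1 powr p"
      using bounded_return_time[OF \<phi> stable min, of "K + 1" "\<eta>1 powr p"] \<open>0 \<le> K\<close> \<eta>1(1) by auto
    have "\<exists>h. 0 \<le> h \<and> h \<le> real n \<and> d K (t + h) s < \<eta>" if ts: "real n \<le> t" "real n \<le> s" for t s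
    proof -
      obtain h where h: "0 \<le> h" "h \<le> real n"
        "pdist (K + 1) (\<lambda>x. \<phi> (x + (t + h))) (\<lambda>x. \<phi> (x + s)) < \<eta>1 powr p"
        using n[OF ts] by blast
      have pos: "0 \<le> t + h" "0 \<le> s" using ts h(1) of_nat_0_le_iff[of n] by linarith+
      have "d K (t + h) s \<le> d (K + 1) (t + h) s"
        using pos by (intro d_mono) auto
      also have "\<dots> \<le> (K + 1) * \<eta>1
          + \<eta>1 powr (1 - p) * rho p {0..K + 1} (\<lambda>x. \<phi> (x + (t + h))) (\<lambda>x. \<phi> (x + s))"
        using pos \<open>0 \<le> K\<close> \<eta>1(1) by (intro d_le_rho \<phi>) auto
      also have "\<dots> < (K + 1) * \<eta>1 + \<eta>1 powr (1 - p) * \<eta>1 powr p"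
      proof -
        have "rho p {0..K + 1} (\<lambda>x. \<phi> (x + (t + h))) (\<lambda>x. \<phi> (x + s)) < \<eta>1 powr p"
          using rho_le_pdist[OF Lp_loc_fun_shift[OF \<phi> T_nonneg[OF pos(1)]]
              Lp_loc_fun_shift[OF \<phi> T_nonneg[OF pos(2)]], of "K + 1"] h(3) \<open>0 \<le> K\<close> by simp
        then show ?thesis using \<eta>1(1) by simp
      qed
      also have "\<dots> = \<eta>" using \<eta>1 by (simp add: powr_add[symmetric])
      finally show ?thesis using h(1,2) by blast
    qed
    then show "\<exists>L\<ge>0. \<exists>R\<ge>0. \<forall>t\<ge>R. \<forall>s\<ge>R. \<exists>h. 0 \<le> h \<and> h \<le> L \<and> d K (t + h) s < \<eta>"
      using of_nat_0_le_iff[of n] by blast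
  qed
qed

section \<open>Transfer to the primitive\<close>

lemma Sp_diff_eq_rho:
  assumes "\<phi> \<in> Lp_loc_fun p T" "0 \<le> t" "0 \<le> t + \<tau>"
  shows "Sp_diff p \<phi> \<tau> t = rho p {0..1} (\<lambda>x. \<phi> (x + (t + \<tau>))) (\<lambda>x. \<phi> (x + t))"
proof -
  have "(\<lambda>x. norm (\<phi> (x + (t + \<tau>)) - \<phi> (x + t)) powr p) absolutely_integrable_on {0..1}"
    using rho_integrable[OF Lp_loc_fun_shift[OF assms(1) T_nonneg[OF assms(3)]]
        Lp_loc_fun_shift[OF assms(1) T_nonneg[OF assms(2)]] T_Icc[OF T_nonneg]]
    by (intro nonnegative_absolutely_integrable_1) auto
  then have "integrable (lebesgue_on {0..1}) (\<lambda>x. norm (\<phi> (x + (t + \<tau>)) - \<phi> (x + t)) powr p)"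
    by (rule absolutely_integrable_imp_integrable) simp
  from lebesgue_integral_eq_integral[OF this] show ?thesis
    by (simp add: Sp_diff_def rho_def add.commute)
qed

text \<open>\<open>d_le_rho\<close> on the unit window with parameter \<delta>/3: each of the two
  terms contributes at most \<delta>/3, leaving a margin.\<close>

lemma d_less_if_Sp_diff_less:
  assumes "\<phi> \<in> Lp_loc_fun p T" "0 \<le> t" "0 \<le> t + \<tau>" "0 < \<delta>"
    and "Sp_diff p \<phi> \<tau> t < (\<delta> / 3) powr p"
  shows "locally_integrable.d \<phi> 1 (t + \<tau>) t < \<delta>"
proof -
  have "locally_integrable.d \<phi> 1 (t + \<tau>) t \<le> 1 * (\<delta> / 3) + (\<delta> / 3) powr (1 - p) * Sp_diff p \<phi> \<tau> t"
    unfolding Sp_diff_eq_rho[OF assms(1-3)] using assms by (intro d_le_rho) auto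
  also have "\<dots> < 1 * (\<delta> / 3) + (\<delta> / 3) powr (1 - p) * (\<delta> / 3) powr p"
    using assms(4,5) by simp
  also have "(\<delta> / 3) powr (1 - p) * (\<delta> / 3) powr p = \<delta> / 3"
    using assms(4) by (simp add: powr_add[symmetric])
  finally show ?thesis using assms(4) by simp
qed

lemma F_eq_primitive:
  assumes "\<phi> \<in> Lp_loc_fun p T" "0 \<le> t"
  shows "locally_integrable.F \<phi> t = primitive \<phi> t"
proof -
  interpret locally_integrable \<phi> by (rule locally_integrable_Lp[OF assms(1)])
  show ?thesis
    using Lp_loc_fun_integrable(2)[OF assms(1) T_Icc[OF T_nonneg]] assms(2)
    by (simp add: F_def primitive_def)
qed

lemma primitive_remotely_periodic:
  assumes \<phi>: "\<phi> \<in> Lp_loc_fun p T" and \<tau>: "0 < \<tau>"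
    and lim: "(Sp_diff p \<phi> \<tau> \<longlongrightarrow> 0) at_top"
    and bdd: "bounded (primitive \<phi> ` {0..})"
  shows "((\<lambda>t. norm (primitive \<phi> (t + \<tau>) - primitive \<phi> t)) \<longlongrightarrow> 0) at_top"
proof -
  interpret locally_integrable \<phi> by (rule locally_integrable_Lp[OF \<phi>])
  have "((\<lambda>t. d 1 (t + \<tau>) t) \<longlongrightarrow> 0) at_top"
  proof (rule tendstoI)
    fix \<delta> :: real assume "0 < \<delta>"
    then have "\<forall>\<^sub>F t in at_top. Sp_diff p \<phi> \<tau> t < (\<delta> / 3) powr p"
      using lim by (intro order_tendstoD(2)) auto
    then show "\<forall>\<^sub>F t in at_top. dist (d 1 (t + \<tau>) t) 0 < \<delta>"
      using eventually_ge_at_top[of 0]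
    proof eventually_elim
      case (elim t)
      have "0 \<le> d 1 (t + \<tau>) t"
        unfolding d_def using elim \<tau> by (intro Henstock_Kurzweil_Integration.integral_nonneg integrable_diff) auto
      then show ?case using d_less_if_Sp_diff_less[OF \<phi> _ _ \<open>0 < \<delta>\<close> elim(1)] elim(2) \<tau> by simp
    qed
  qed
  moreover have "F ` {0..} = primitive \<phi> ` {0..}"
    using F_eq_primitive[OF \<phi>] by (intro image_cong) auto
  ultimately have "((\<lambda>t. norm (F (t + \<tau>) - F t)) \<longlongrightarrow> 0) at_top"
    using F_increment_tendsto_0[OF \<tau>] bdd by simp
  moreover have "\<forall>\<^sub>F t in at_top. norm (F (t + \<tau>) - F t) = norm (primitive \<phi> (t + \<tau>) - primitive \<phi> t)"
    using eventually_ge_at_top[of 0] by eventually_elim (use \<tau> in \<open>simp add: F_eq_primitive[OF \<phi>]\<close>)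
  ultimately show ?thesis by (rule Lim_transform_eventually)
qed

lemma primitive_remotely_almost_periodic:
  assumes \<phi>: "\<phi> \<in> Lp_loc_fun p T"
    and stable: "pos_Lagrange_stable (Lp_loc p T) (Lp_shift p T) (Lp_class p T \<phi>)"
    and min: "minimal_set T (Lp_loc p T) (Lp_shift p T)
      (omega_limit_set T (Lp_loc p T) (Lp_shift p T) (Lp_class p T \<phi>))"
    and cpt: "compact (closure (primitive \<phi> ` {0..}))"
    and ap: "Sp_remotely_almost_periodic p T \<phi>"
  shows "pos_remotely_almost_periodic T (primitive \<phi>)"
  unfolding pos_remotely_almost_periodic_def
proof (intro conjI allI impI)
  show "continuous_on T (primitive \<phi>)" by (rule primitive_continuous[OF \<phi>])
  interpret locally_integrable \<phi> by (rule locally_integrable_Lp[OF \<phi>])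
  fix \<epsilon> :: real assume "0 < \<epsilon>"
  have "F ` {0..} = primitive \<phi> ` {0..}"
    using F_eq_primitive[OF \<phi>] by (intro image_cong) auto
  then have "compact (closure (F ` {0..}))" using cpt by simp
  then obtain \<delta> where \<delta>: "0 < \<delta>"
    and small: "\<And>\<tau>. almost_period \<delta> \<tau> \<Longrightarrow> \<exists>R. \<forall>t\<ge>R. norm (F (t + \<tau>) - F t) < \<epsilon>"
    by (rule F_increment_small[OF uniformly_recurrent_minimal[OF \<phi> stable min] _ \<open>0 < \<epsilon>\<close>]) (rule that; blast)
  have "0 < \<delta> / 3" using \<delta> by simp
  then obtain P where P: "relatively_dense T P"
    and ap_P: "\<And>\<tau>. \<tau> \<in> P \<Longrightarrow> \<exists>L>0. \<forall>t\<ge>L. Sp_diff p \<phi> \<tau> t < (\<delta> / 3) powr p"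
    using ap unfolding Sp_remotely_almost_periodic_def by blast
  have "\<exists>L>0. \<forall>t\<ge>L. norm (primitive \<phi> (t + \<tau>) - primitive \<phi> t) < \<epsilon>" if "\<tau> \<in> P" for \<tau>
  proof -
    obtain L where L: "0 < L" "\<And>t. t \<ge> L \<Longrightarrow> Sp_diff p \<phi> \<tau> t < (\<delta> / 3) powr p"
      using ap_P[OF \<open>\<tau> \<in> P\<close>] by blast
    \<comment> \<open>On the whole line \<open>P\<close> may contain negative \<tau>. Beyond
      \<open>\<bar>\<tau>\<bar>\<close> the time \<open>t + \<tau>\<close> is still nonnegative, and
      by symmetry of \<open>d\<close> the absolute value of \<tau> is an almost period as
      well.\<close>
    define R where "R = max L \<bar>\<tau>\<bar>"
    have d: "d 1 (t + \<tau>) t < \<delta>" if "t \<ge> R" for t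
      using that L by (intro d_less_if_Sp_diff_less \<phi> \<delta>) (auto simp: R_def)
    have "0 \<le> R" using L(1) by (simp add: R_def)
    have "almost_period \<delta> \<bar>\<tau>\<bar>"
      unfolding almost_period_def
    proof (intro conjI exI[of _ R] allI impI)
      fix t assume "R \<le> t"
      show "d 1 (t + \<bar>\<tau>\<bar>) t < \<delta>"
      proof (cases "0 \<le> \<tau>")
        case True
        then show ?thesis using d[OF \<open>R \<le> t\<close>] by simp
      next
        case False
        then show ?thesis using d[of "t - \<tau>"] \<open>R \<le> t\<close> by (simp add: d_commute[of 1 "t - \<tau>"])
      qed
    qed (use \<open>0 \<le> R\<close> in auto)
    then obtain R' where R': "\<And>t. t \<ge> R' \<Longrightarrow> norm (F (t + \<bar>\<tau>\<bar>) - F t) < \<epsilon>"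
      using small by blast
    \<comment> \<open>For negative \<tau> the increment is read backwards from
      \<open>t + \<tau>\<close>, which must lie beyond \<open>R'\<close>; hence the extra
      \<open>\<bar>\<tau>\<bar>\<close> in the threshold.\<close>
    show ?thesis
    proof (intro exI[of _ "max 1 (max R' 0 + \<bar>\<tau>\<bar>)"] conjI allI impI)
      fix t assume t: "max 1 (max R' 0 + \<bar>\<tau>\<bar>) \<le> t"
      then have t': "R' \<le> t" "R' \<le> t + \<tau>" "0 \<le> t" "0 \<le> t + \<tau>" by linarith+
      have "norm (F (t + \<tau>) - F t) < \<epsilon>"
      proof (cases "0 \<le> \<tau>")
        case True
        then show ?thesis using R'[of t] t' by simp
      next
        case False
        then show ?thesis using R'[of "t + \<tau>"] t' by (simp add: norm_minus_commute)
      qed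
      then show "norm (primitive \<phi> (t + \<tau>) - primitive \<phi> t) < \<epsilon>"
        using t' F_eq_primitive[OF \<phi>, of t] F_eq_primitive[OF \<phi>, of "t + \<tau>"] by simp
    qed simp
  qed
  then show "\<exists>P. relatively_dense T P \<and>
      (\<forall>\<tau>\<in>P. \<exists>L>0. \<forall>t\<ge>L. norm (primitive \<phi> (t + \<tau>) - primitive \<phi> t) < \<epsilon>)"
    using P by blast
qed

end

theorem theorem3p12:
  fixes T :: "real set" and p :: real and \<phi> :: "real \<Rightarrow> 'a::banach"
  assumes "T = {0..} \<or> T = UNIV"
    and "1 \<le> p"
    and "\<phi> \<in> Lp_loc_fun p T"
    and "pos_Lagrange_stable (Lp_loc p T) (Lp_shift p T) (Lp_class p T \<phi>)"
    and "minimal_set T (Lp_loc p T) (Lp_shift p T)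
           (omega_limit_set T (Lp_loc p T) (Lp_shift p T) (Lp_class p T \<phi>))"
    and "compact (closure (primitive \<phi> ` {0..}))"
  shows "(Sp_remotely_almost_periodic p T \<phi> \<longrightarrow> pos_remotely_almost_periodic T (primitive \<phi>)) \<and>
         (\<forall>\<tau>>0. Sp_remotely_periodic p T \<tau> \<phi> \<longrightarrow> pos_remotely_periodic T \<tau> (primitive \<phi>)) \<and>
         (Sp_remotely_stationary p T \<phi> \<longrightarrow> pos_remotely_stationary T (primitive \<phi>))"
proof -
  interpret Lp_space T p by unfold_locales (rule assms(1,2))+
  have "bounded (primitive \<phi> ` {0..})"
    using assms(6) bounded_subset[OF compact_imp_bounded closure_subset] by blast
  then have per: "pos_remotely_periodic T \<tau> (primitive \<phi>)" if "Sp_remotely_periodic p T \<tau> \<phi>" for \<tau>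
    using that primitive_continuous[OF assms(3)] primitive_remotely_periodic[OF assms(3)]
    by (auto simp: pos_remotely_periodic_def Sp_remotely_periodic_def)
  then show ?thesis
    using primitive_remotely_almost_periodic[OF assms(3-6)]
    by (auto simp: pos_remotely_stationary_def Sp_remotely_stationary_def)
qed

end
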